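(* Let $u\in U(n)$ be a unitary operator on $\mathbb C^n$ and let $e$ be a unit cyclic vector for $u$. Let $\mu$ be the spectral measure of the pair $(u,e)$, $(\alpha_0,\dots,\alpha_{n-1})$ its Verblunsky coefficients and $(\gamma_0,\dots,\gamma_{n-1})$ its deformed Verblunsky coefficients. Let $(\varepsilon_1,\dots,\varepsilon_n)$ be the orthonormal basis obtained from the Gram–Schmidt procedure applied to $(e,ue,\dots,u^{n-1}e)$. Then $u$ can be decomposed as a product of $n$ reflections $$u=r_1r_2\cdots r_n,$$ where $r_1$ is the reflection mapping $\varepsilon_1$ onto $u\varepsilon_1$ and, by induction, for each $2\le k\le n$, $r_k$ is the reflection mapping $\varepsilon_k$ onto $r_{k-1}^{-1}r_{k-2}^{-1}\cdots r_1^{-1}u\varepsilon_k$. This decomposition can also be restated in terms of the GGT matrix: $$\mathcal G(\alpha_0,\dots,\alpha_{n-1})=\Xi^{(0)}(\gamma_0)\,\Xi^{(1)}(\gamma_1)\cdots\Xi^{(n-1)}(\gamma_{n-1}),$$ where $\Xi^{(k)}(\gamma_k)=\mathrm{Id}_k\oplus\Xi(\gamma_k)\oplus\mathrm{Id}_{n-k-2}$ for $0\le k\le n-2$, and $\Xi^{(n-1)}(\gamma_{n-1})=\mathrm{Id}_{n-1}\oplus(\gamma_{n-1})$.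
   Context: Inner products $\langle x,y\rangle=\sum_k\overline{x}_ky_k$ are linear in the second argument. $\mathbb D=\{|z|<1\}$, $\mathbb T=\{|z|=1\}$. A vector $e$ is cyclic for $u$ if $e,ue,\dots,u^{n-1}e$ span $\mathbb C^n$. The spectral measure of $(u,e)$ is the probability measure $\mu$ on $\mathbb T$ with $\langle e,u^ke\rangle=\int z^k\,d\mu(z)$ for all $k\in\mathbb Z$; it is supported at exactly $n$ points $e^{\mathrm i\theta_1},\dots,e^{\mathrm i\theta_n}$. Verblunsky coefficients: let $\Phi_0,\dots,\Phi_{n-1}$ be the monic orthogonal polynomials of $\mu$, $\Phi_n(z)=\prod_{j=1}^n(z-e^{\mathrm i\theta_j})$, and $\Phi_j^*(z)=z^j\overline{\Phi_j(1/\bar z)}$. The Verblunsky coefficients $\alpha_0,\dots,\alpha_{n-2}\in\mathbb D$, $\alpha_{n-1}\in\mathbb T$ are defined by Szegő's recursion $\Phi_{j+1}(z)=z\Phi_j(z)-\bar\alpha_j\Phi_j^*(z)$, $0\le j\le n-1$. The map $\mu\mapsto(\alpha_0,\dots,\alpha_{n-1})$ is a bijection from probability measures supported at $n$ points onto $\mathbb D^{n-1}\times\mathbb T$. Deformed Verblunsky coefficients: $\gamma_k:=\gamma_k(1)$ with $\gamma_k(z)=z-\Phi_{k+1}(z)/\Phi_k(z)$, $0\le k\le n-1$. GGT matrix: $\mathcal G(\alpha_0,\dots,\alpha_{n-1})$ is the matrix of the operator $f(z)\mapsto zf(z)$ on $L^2(\mathbb T,\mu)$ in the basis of orthonormal polynomials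 $\Phi_j/\|\Phi_j\|$, $0\le j\le n-1$, where $\mu$ is the measure with Verblunsky coefficients $(\alpha_0,\dots,\alpha_{n-1})$. Reflections: an element $r\in U(n)$ is a reflection if $r-\mathrm{Id}$ has rank $0$ or $1$. For unit vectors $e\ne m$ there is a unique reflection with $r(e)=m$, namely $r=\mathrm{Id}-\frac{1}{1-\langle m,e\rangle}(m-e)\langle m-e,\cdot\rangle$; "the reflection mapping $e$ onto $e$" means the identity. For $\gamma\in\mathbb D$, $$\Xi(\gamma)=\begin{pmatrix}\gamma&\rho e^{\mathrm i\varphi}\\ \rho&-\bar\gamma e^{\mathrm i\varphi}\end{pmatrix},\qquad \rho=\sqrt{1-|\gamma|^2},\quad e^{\mathrm i\varphi}=\frac{1-\gamma}{1-\bar\gamma}.$$ *)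

theory Defs
  imports
    "HOL-Probability.Probability_Measure"
    "Jordan_Normal_Form.Schur_Decomposition"
    "Jordan_Normal_Form.Gauss_Jordan_Elimination"
    "Jordan_Normal_Form.DL_Rank"
begin

section \<open>Linear algebra on the space of complex column vectors of length n\<close>

text \<open>Indices start at 0 throughout: the vector called \<open>\<epsilon>\<^sub>k\<close> for \<open>1 \<le> k \<le> n\<close> in the usual
  numbering is entry \<open>k - 1\<close> of a list, and the reflections are indexed by \<open>0, \<dots>, n - 1\<close>.\<close>

text \<open>The library product \<open>v \<bullet>c w\<close> conjugates its second argument; the inner product
  used here is linear in the second argument.\<close>

definition hinner :: "complex vec \<Rightarrow> complex vec \<Rightarrow> complex" where
  "hinner x y = y \<bullet>c x"

definition hnorm :: "complex vec \<Rightarrow> real" where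
  "hnorm x = sqrt (Re (hinner x x))"

definition is_unitary :: "nat \<Rightarrow> complex mat \<Rightarrow> bool" where
  "is_unitary n u \<longleftrightarrow>
     u \<in> carrier_mat n n \<and> mat_adjoint u * u = 1\<^sub>m n \<and> u * mat_adjoint u = 1\<^sub>m n"

text \<open>Only meaningful for invertible matrices.\<close>

definition minv :: "complex mat \<Rightarrow> complex mat" where
  "minv A = the (mat_inverse A)"

definition mpowi :: "complex mat \<Rightarrow> int \<Rightarrow> complex mat" where
  "mpowi A k = (if 0 \<le> k then A ^\<^sub>m nat k else minv A ^\<^sub>m nat (- k))"

definition mprod :: "nat \<Rightarrow> complex mat list \<Rightarrow> complex mat" where
  "mprod n As = foldr (*) As (1\<^sub>m n)"

definition krylov :: "nat \<Rightarrow> complex mat \<Rightarrow> complex vec \<Rightarrow> complex vec list" where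
  "krylov n u e = map (\<lambda>k. (u ^\<^sub>m k) *\<^sub>v e) [0..<n]"

definition cyclic_vector :: "nat \<Rightarrow> complex mat \<Rightarrow> complex vec \<Rightarrow> bool" where
  "cyclic_vector n u e \<longleftrightarrow> e \<in> carrier_vec n \<and>
     LinearCombinations.module.span class_ring (module_vec TYPE(complex) n) (set (krylov n u e))
       = carrier_vec n"

text \<open>The library procedure \<open>gram_schmidt\<close> orthogonalises without normalising.\<close>

definition gram_schmidt_onb :: "nat \<Rightarrow> complex vec list \<Rightarrow> complex vec list" where
  "gram_schmidt_onb n vs =
     map (\<lambda>v. complex_of_real (1 / hnorm v) \<cdot>\<^sub>v v) (gram_schmidt n vs)"

subsection \<open>Reflections\<close>

definition is_reflection :: "nat \<Rightarrow> complex mat \<Rightarrow> bool" where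
  "is_reflection n r \<longleftrightarrow> is_unitary n r \<and> vec_space.rank n (r - 1\<^sub>m n) \<le> 1"

text \<open>For unit vectors \<open>e \<noteq> m\<close>, \<open>reflection_onto n e m\<close> is the matrix of
  \<open>Id - (1 - \<langle>m,e\<rangle>)\<^sup>-\<^sup>1 (m - e) \<langle>m - e, \<cdot>\<rangle>\<close>.\<close>

definition reflection_onto :: "nat \<Rightarrow> complex vec \<Rightarrow> complex vec \<Rightarrow> complex mat" where
  "reflection_onto n e m =
     (if e = m then 1\<^sub>m n
      else 1\<^sub>m n - (1 / (1 - hinner m e)) \<cdot>\<^sub>m
             mat n n (\<lambda>(i, j). vec_index (m - e) i * cnj (vec_index (m - e) j)))"

section \<open>Measures on the unit circle\<close>

text \<open>A measure on the unit circle is represented as a Borel measure on the complex plane for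
  which almost every point lies on the circle.\<close>

definition circle_prob :: "complex measure \<Rightarrow> bool" where
  "circle_prob \<mu> \<longleftrightarrow> prob_space \<mu> \<and> sets \<mu> = sets borel \<and> (AE z in \<mu>. z \<in> sphere 0 1)"

definition mass_points :: "complex measure \<Rightarrow> complex set" where
  "mass_points \<mu> = {z. measure \<mu> {z} > 0}"

definition supported_at :: "nat \<Rightarrow> complex measure \<Rightarrow> bool" where
  "supported_at n \<mu> \<longleftrightarrow>
     finite (mass_points \<mu>) \<and> card (mass_points \<mu>) = n \<and> (AE z in \<mu>. z \<in> mass_points \<mu>)"

definition spectral_measure :: "nat \<Rightarrow> complex mat \<Rightarrow> complex vec \<Rightarrow> complex measure" where
  "spectral_measure n u e =
     (THE \<mu>. circle_prob \<mu> \<and>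
        (\<forall>k::int. hinner e (mpowi u k *\<^sub>v e) = (\<integral>z. z powi k \<partial>\<mu>)))"

definition L2_inner :: "complex measure \<Rightarrow> (complex \<Rightarrow> complex) \<Rightarrow> (complex \<Rightarrow> complex) \<Rightarrow> complex" where
  "L2_inner \<mu> f g = (\<integral>z. cnj (f z) * g z \<partial>\<mu>)"

definition L2_norm :: "complex measure \<Rightarrow> (complex \<Rightarrow> complex) \<Rightarrow> real" where
  "L2_norm \<mu> f = sqrt (Re (L2_inner \<mu> f f))"

subsection \<open>Monic orthogonal polynomials and Verblunsky coefficients\<close>

text \<open>For \<open>\<mu>\<close> supported at exactly \<open>n\<close> points, the polynomials are used for \<open>0 \<le> j \<le> n\<close>, the
  last one vanishing at the mass points.\<close>

definition monic_OP :: "complex measure \<Rightarrow> nat \<Rightarrow> complex poly" where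
  "monic_OP \<mu> j =
     (if j < card (mass_points \<mu>)
      then (THE p. degree p = j \<and> lead_coeff p = 1 \<and>
              (\<forall>q. degree q < j \<longrightarrow> L2_inner \<mu> (poly q) (poly p) = 0))
      else (\<Prod>w\<in>mass_points \<mu>. [:- w, 1:]))"

text \<open>\<open>szego_rev \<mu> j z\<close> is the value of the reversed polynomial at \<open>z \<noteq> 0\<close>.\<close>

definition szego_rev :: "complex measure \<Rightarrow> nat \<Rightarrow> complex \<Rightarrow> complex" where
  "szego_rev \<mu> j z = z ^ j * cnj (poly (monic_OP \<mu> j) (1 / cnj z))"

definition verblunsky :: "complex measure \<Rightarrow> nat \<Rightarrow> complex" where
  "verblunsky \<mu> j =
     (THE a. \<forall>z. z \<noteq> 0 \<longrightarrow>
        poly (monic_OP \<mu> (Suc j)) z = z * poly (monic_OP \<mu> j) z - cnj a * szego_rev \<mu> j z)"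

definition deformed_verblunsky_fun :: "complex measure \<Rightarrow> nat \<Rightarrow> complex \<Rightarrow> complex" where
  "deformed_verblunsky_fun \<mu> k z = z - poly (monic_OP \<mu> (Suc k)) z / poly (monic_OP \<mu> k) z"

definition deformed_verblunsky :: "complex measure \<Rightarrow> nat \<Rightarrow> complex" where
  "deformed_verblunsky \<mu> k = deformed_verblunsky_fun \<mu> k 1"

subsection \<open>GGT matrices\<close>

definition orthonormal_OP :: "complex measure \<Rightarrow> nat \<Rightarrow> complex \<Rightarrow> complex" where
  "orthonormal_OP \<mu> j z =
     poly (monic_OP \<mu> j) z / complex_of_real (L2_norm \<mu> (poly (monic_OP \<mu> j)))"

text \<open>The matrix of multiplication by \<open>z\<close>: column \<open>j\<close> holds the coordinates of the image of
  the \<open>j\<close>-th basis function, equality in \<open>L\<^sup>2\<close> being equality almost everywhere.\<close>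

definition mult_matrix :: "nat \<Rightarrow> complex measure \<Rightarrow> complex mat" where
  "mult_matrix n \<mu> =
     (THE G. G \<in> carrier_mat n n \<and>
        (\<forall>j<n. AE z in \<mu>. z * orthonormal_OP \<mu> j z =
                  (\<Sum>i<n. index_mat G (i, j) * orthonormal_OP \<mu> i z)))"

definition measure_of_verblunsky :: "nat \<Rightarrow> (nat \<Rightarrow> complex) \<Rightarrow> complex measure" where
  "measure_of_verblunsky n \<alpha> =
     (THE \<mu>. circle_prob \<mu> \<and> supported_at n \<mu> \<and> (\<forall>k<n. verblunsky \<mu> k = \<alpha> k))"

definition GGT :: "nat \<Rightarrow> (nat \<Rightarrow> complex) \<Rightarrow> complex mat" where
  "GGT n \<alpha> = mult_matrix n (measure_of_verblunsky n \<alpha>)"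

subsection \<open>The elementary factors\<close>

definition Xi :: "complex \<Rightarrow> complex mat" where
  "Xi \<gamma> =
     (let \<rho> = complex_of_real (sqrt (1 - (cmod \<gamma>)\<^sup>2)); ph = (1 - \<gamma>) / (1 - cnj \<gamma>)
      in mat_of_rows_list 2 [[\<gamma>, \<rho> * ph], [\<rho>, - cnj \<gamma> * ph]])"

definition Xi_block :: "nat \<Rightarrow> nat \<Rightarrow> complex \<Rightarrow> complex mat" where
  "Xi_block n k \<gamma> =
     (if k + 1 < n then diag_block_mat [1\<^sub>m k, Xi \<gamma>, 1\<^sub>m (n - k - 2)]
      else diag_block_mat [1\<^sub>m (n - 1), mat_of_rows_list 1 [[\<gamma>]]])"

end

theory Submission
  imports Defs
begin

text \<open>The reflections \<open>r\<^sub>1, r\<^sub>2, \<dots>\<close> successively strip \<open>u\<close>: the operator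
  \<open>r\<^sub>k\<^sup>-\<^sup>1 \<cdots> r\<^sub>1\<^sup>-\<^sup>1 u\<close> is unitary and fixes the first \<open>k\<close> basis vectors, so after \<open>n\<close> steps it is
  the identity. In the Gram-Schmidt basis, which corresponds to the orthonormal polynomials
  \<open>\<phi>\<^sub>j\<close> of the spectral measure, \<open>u\<close> is a Hessenberg matrix; hence the \<open>k\<close>-th reflection acts on the
  span of two consecutive basis vectors, as \<open>\<Xi>(a)\<close> for some \<open>a\<close>. To identify \<open>a\<close>, consider the
  functional that evaluates polynomials at \<open>1\<close>. Multiplication by \<open>z\<close> preserves it in degrees
  less than \<open>n - 1\<close>, therefore so do the reflections, and this reads
  \<open>a \<phi>\<^sub>k(1) + \<rho> \<phi>\<^sub>k\<^sub>+\<^sub>1(1) = \<phi>\<^sub>k(1)\<close> with \<open>\<rho> = \<parallel>\<Phi>\<^sub>k\<^sub>+\<^sub>1\<parallel> / \<parallel>\<Phi>\<^sub>k\<parallel>\<close>, that is, \<open>a = 1 - \<Phi>\<^sub>k\<^sub>+\<^sub>1(1) / \<Phi>\<^sub>k(1)\<close>.\<close>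

hide_const (open) Module.smult Coset.order

section \<open>Orthogonal polynomials on the unit circle\<close>

text \<open>The spectral measure, the orthogonal polynomials, their coefficients and the GGT matrix
  are all definite descriptions, so each needs existence and uniqueness before it can be computed.
  For the spectral measure, existence comes from a polynomial model: by cyclicity, mapping
  \<open>p\<close> to p(u) e is a bijection from degree below \<open>n\<close> onto the whole space.
  In this model \<open>u\<close> is multiplication by \<open>z\<close>, and the eigenvalues appear
  as roots of the polynomial of degree \<open>n\<close> that annihilates \<open>e\<close>.
  Uniqueness must exclude every probability measure on the circle, including those with infinite
  support.

  Solving for \<open>a\<close> requires that \<open>\<Phi>\<^sub>k(1)\<close> be nonzero for
  \<open>k < n\<close>. This follows from the positive subdiagonal: a column of length one with
  \<open>\<rho> > 0\<close> has \<open>a\<close> different from \<open>1\<close>, so nonvanishing at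
  \<open>1\<close> passes from each orthonormal polynomial to the next. Only
  \<open>\<Phi>\<^sub>n(1)\<close> can be zero; then \<open>1\<close> is an eigenvalue and the last
  reflection is the identity.\<close>

lemma degree_monom_diff:
  fixes q :: "'a::comm_ring_1 poly"
  assumes "degree q < k" shows "degree (monom 1 k - q) = k"
  using degree_add_eq_left[of "- q" "monom 1 k"] assms by (simp add: degree_monom_eq)

lemma monic_diff_degree:
  fixes p q :: "'a::comm_ring_1 poly"
  assumes "p \<noteq> q" "degree p = k" "degree q = k" "lead_coeff p = lead_coeff q"
  shows "degree (q - p) < k"
proof -
  have "degree (q - p) \<le> k"
    using assms by (metis degree_diff_le order_refl)
  moreover have "coeff (q - p) k = 0"
    using assms by simp
  ultimately show ?thesis using assms
    by (metis le_neq_implies_less leading_coeff_0_iff right_minus_eq)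
qed

section \<open>Measures carried by finitely many points\<close>

lemma integral_AE_finite:
  fixes f :: "complex \<Rightarrow> complex"
  assumes "finite_measure M" and sets: "sets M = sets borel"
    and S: "finite S" "AE z in M. z \<in> S" and f: "f \<in> borel_measurable borel"
  shows "(\<integral>z. f z \<partial>M) = (\<Sum>z\<in>S. of_real (measure M {z}) * f z)"
proof -
  interpret finite_measure M by fact
  have space: "space M = UNIV" using sets_eq_imp_space_eq[OF sets] by simp
  have [measurable]: "f \<in> borel_measurable M"
    using f measurable_cong_sets[OF sets refl] by blast
  have [measurable]: "{z} \<in> sets M" for z
    unfolding sets by simp
  have int: "integrable M (indicator {w} :: complex \<Rightarrow> real)" for w
    by (intro integrable_real_indicator) (simp_all add: emeasure_eq_measure)
  have "(\<integral>z. f z \<partial>M) = (\<integral>z. (\<Sum>w\<in>S. indicator {w} z *\<^sub>R f w) \<partial>M)"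
  proof (rule integral_cong_AE)
    have pt: "f z = (\<Sum>w\<in>S. indicator {w} z *\<^sub>R f w)" if z: "z \<in> S" for z
    proof -
      have "(\<Sum>w\<in>S. indicator {w} z *\<^sub>R f w) = (\<Sum>w\<in>{z}. indicator {w} z *\<^sub>R f w)"
        using z S(1) by (intro sum.mono_neutral_right) (auto simp: indicator_def)
      then show ?thesis by simp
    qed
    show "AE z in M. f z = (\<Sum>w\<in>S. indicator {w} z *\<^sub>R f w)"
      using S(2) by eventually_elim (rule pt)
  qed measurable
  also have "\<dots> = (\<Sum>w\<in>S. (\<integral>z. indicator {w} z *\<^sub>R f w \<partial>M))"
    by (intro Bochner_Integration.integral_sum integrable_scaleR_left int)
  also have "\<dots> = (\<Sum>z\<in>S. of_real (measure M {z}) * f z)"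
    by (intro sum.cong refl, subst integral_scaleR_left[OF int]) (simp add: scaleR_conv_of_real space)
  finally show ?thesis .
qed

text \<open>Lagrange interpolation recovers the mass of each point.\<close>

lemma finite_measure_eqI_poly:
  fixes M N :: "complex measure"
  assumes M: "finite_measure M" "sets M = sets borel" "AE z in M. z \<in> S"
    and N: "finite_measure N" "sets N = sets borel" "AE z in N. z \<in> S"
    and S: "finite S"
    and eq: "\<And>q. degree q < card S \<Longrightarrow> (\<integral>z. poly q z \<partial>M) = (\<integral>z. poly q z \<partial>N)"
  shows "M = N"
proof -
  interpret M: finite_measure M by fact
  interpret N: finite_measure N by fact
  have mass: "measure M {w} = measure N {w}" if w: "w \<in> S" for w
  proof -
    define L where "L = (\<Prod>v\<in>S - {w}. [:- v, 1:])"
    have zero: "poly L z = 0" if "z \<in> S - {w}" for z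
      using that S by (simp add: L_def poly_prod)
    have int: "(\<integral>z. poly L z \<partial>K) = of_real (measure K {w}) * poly L w"
      if K: "finite_measure K" "sets K = sets borel" "AE z in K. z \<in> S" for K
    proof -
      have "(\<integral>z. poly L z \<partial>K) = (\<Sum>z\<in>S. of_real (measure K {z}) * poly L z)"
        by (intro integral_AE_finite K S borel_measurable_continuous_onI continuous_intros)
      also have "\<dots> = (\<Sum>z\<in>{w}. of_real (measure K {z}) * poly L z)"
        using w S zero by (intro sum.mono_neutral_right) auto
      finally show ?thesis by simp
    qed
    have "degree L = card S - 1"
      using S w by (simp add: L_def degree_prod_eq_sum_degree)
    moreover have "card S > 0" using S w by (auto simp: card_gt_0_iff)
    ultimately have "(\<integral>z. poly L z \<partial>M) = (\<integral>z. poly L z \<partial>N)"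
      by (intro eq) simp
    moreover have "poly L w \<noteq> 0" using S by (simp add: L_def poly_prod)
    ultimately show ?thesis using int[OF M] int[OF N] by simp
  qed
  have meas: "of_real (measure K A) = (\<Sum>z\<in>S. of_real (measure K {z}) * complex_of_real (indicator A z))"
    if K: "finite_measure K" "sets K = sets borel" "AE z in K. z \<in> S" and A: "A \<in> sets borel" for K A
  proof -
    have "(\<integral>z. complex_of_real (indicator A z) \<partial>K) = of_real (measure K A)"
      using A K(2) sets_eq_imp_space_eq[OF K(2)] unfolding integral_complex_of_real by simp
    moreover have "(\<integral>z. complex_of_real (indicator A z) \<partial>K) = (\<Sum>z\<in>S. of_real (measure K {z}) * complex_of_real (indicator A z))"
      using A by (intro integral_AE_finite K S) simp
    ultimately show ?thesis by simp
  qed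
  show ?thesis
  proof (rule measure_eqI)
    fix A assume "A \<in> sets M"
    then have A: "A \<in> sets borel" using M by simp
    have "complex_of_real (measure M A) = of_real (measure N A)"
      using meas[OF M A] meas[OF N A] mass by simp
    then show "emeasure M A = emeasure N A"
      by (simp add: M.emeasure_eq_measure N.emeasure_eq_measure)
  qed (use M N in simp)
qed

section \<open>The inner product of polynomials for a finitely supported circle measure\<close>

locale circle_measure =
  fixes \<mu> :: "complex measure"
  assumes circle: "circle_prob \<mu>"
    and finite_mass: "finite (mass_points \<mu>)"
    and AE_mass: "AE z in \<mu>. z \<in> mass_points \<mu>"
begin

sublocale prob_space \<mu> using circle by (simp add: circle_prob_def)

lemma sets_eq [measurable_cong]: "sets \<mu> = sets borel"
  using circle by (simp add: circle_prob_def)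

text \<open>A null set cannot contain a point of positive mass, so statements in
  \<open>L\<^sup>2\<close> become pointwise statements at the mass points.\<close>

lemma AE_iff_mass: "(AE z in \<mu>. Q z) \<longleftrightarrow> (\<forall>z\<in>mass_points \<mu>. Q z)"
proof
  assume AE: "AE z in \<mu>. Q z"
  show "\<forall>z\<in>mass_points \<mu>. Q z"
  proof (intro ballI, rule ccontr)
    fix z assume z: "z \<in> mass_points \<mu>" "\<not> Q z"
    from AE obtain N where N: "{x \<in> space \<mu>. \<not> Q x} \<subseteq> N" "emeasure \<mu> N = 0" "N \<in> sets \<mu>"
      by (auto elim!: AE_E)
    have "z \<in> space \<mu>"
      using sets_eq_imp_space_eq[OF sets_eq] by simp
    then have "measure \<mu> {z} \<le> measure \<mu> N"
      using N z by (intro finite_measure_mono) auto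
    also have "\<dots> = 0"
      using N by (simp add: measure_def)
    finally show False
      using z by (simp add: mass_points_def)
  qed
next
  assume "\<forall>z\<in>mass_points \<mu>. Q z"
  with AE_mass show "AE z in \<mu>. Q z"
    by auto
qed

lemma norm_mass: "z \<in> mass_points \<mu> \<Longrightarrow> cmod z = 1"
  using circle AE_iff_mass[of "\<lambda>z. z \<in> sphere 0 1"] by (auto simp: circle_prob_def)

lemma mass_pos: "z \<in> mass_points \<mu> \<Longrightarrow> measure \<mu> {z} > 0"
  by (simp add: mass_points_def)

lemma integral_eq_sum:
  fixes f :: "complex \<Rightarrow> complex"
  assumes "f \<in> borel_measurable borel"
  shows "(\<integral>z. f z \<partial>\<mu>) = (\<Sum>z\<in>mass_points \<mu>. of_real (measure \<mu> {z}) * f z)"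
  by (intro integral_AE_finite finite_mass AE_mass assms sets_eq finite_measure_axioms)

definition ip :: "complex poly \<Rightarrow> complex poly \<Rightarrow> complex" where
  "ip p q = L2_inner \<mu> (poly p) (poly q)"

lemma ip_eq: "ip p q = (\<Sum>z\<in>mass_points \<mu>. of_real (measure \<mu> {z}) * (cnj (poly p z) * poly q z))"
  unfolding ip_def L2_inner_def
  by (intro integral_eq_sum borel_measurable_continuous_onI continuous_intros)

lemma mass_cnj:
  assumes "z \<in> mass_points \<mu>" shows "z \<noteq> 0" "z * cnj z = 1" "cnj z * z = 1" "1 / cnj z = z"
proof -
  show "z * cnj z = 1"
    using norm_mass[OF assms] complex_norm_square[of z] by simp
  then show "cnj z * z = 1"
    by (simp add: mult.commute)
  show "z \<noteq> 0"
    using norm_mass[OF assms] by auto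
  with \<open>z * cnj z = 1\<close> show "1 / cnj z = z"
    by (simp add: divide_eq_eq)
qed

lemma ip_add_right: "ip p (q + r) = ip p q + ip p r"
  and ip_add_left: "ip (q + r) p = ip q p + ip r p"
  and ip_diff_right: "ip p (q - r) = ip p q - ip p r"
  and ip_diff_left: "ip (q - r) p = ip q p - ip r p"
  and ip_smult_right: "ip p (smult c q) = c * ip p q"
  and ip_smult_left: "ip (smult c q) p = cnj c * ip q p"
  and ip_0_right [simp]: "ip p 0 = 0"
  and ip_0_left [simp]: "ip 0 p = 0"
  by (simp_all add: ip_eq algebra_simps sum.distrib sum_subtractf sum_distrib_left)

lemma ip_sum_right: "ip p (\<Sum>i\<in>I. q i) = (\<Sum>i\<in>I. ip p (q i))"
  by (induction I rule: infinite_finite_induct) (auto simp: ip_add_right)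

lemma ip_sum_left: "ip (\<Sum>i\<in>I. q i) p = (\<Sum>i\<in>I. ip (q i) p)"
  by (induction I rule: infinite_finite_induct) (auto simp: ip_add_left)

lemma ip_cnj: "cnj (ip p q) = ip q p"
  by (simp add: ip_eq mult_ac)

lemma ip_mult_z: "ip ([:0, 1:] * p) ([:0, 1:] * q) = ip p q"
proof -
  have "cnj (z * a) * (z * b) = cnj a * b" if "z \<in> mass_points \<mu>" for z a b
  proof -
    have "cnj (z * a) * (z * b) = (cnj z * z) * (cnj a * b)"
      by simp
    then show ?thesis
      using mass_cnj(3)[OF that] by simp
  qed
  then show ?thesis
    unfolding ip_eq by (intro sum.cong refl) simp
qed

lemma ip_self: "ip p p = of_real (\<Sum>z\<in>mass_points \<mu>. measure \<mu> {z} * (cmod (poly p z))\<^sup>2)"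
  unfolding ip_eq of_real_sum
proof (intro sum.cong refl)
  fix z
  show "of_real (prob {z}) * (cnj (poly p z) * poly p z) = of_real (prob {z} * (cmod (poly p z))\<^sup>2)"
    unfolding of_real_mult complex_norm_square by (simp only: mult.commute[of "cnj (poly p z)"])
qed

lemma ip_self_nonneg: "0 \<le> Re (ip p p)"
  by (simp add: ip_self sum_nonneg)

lemma ip_self_eq_0_iff: "ip p p = 0 \<longleftrightarrow> (\<forall>z\<in>mass_points \<mu>. poly p z = 0)"
  unfolding ip_self of_real_eq_0_iff
  using finite_mass by (subst sum_nonneg_eq_0_iff) (force dest: mass_pos)+

text \<open>Norm zero means vanishing at every mass point, which is more roots than the degree
  allows. From degree \<open>card (mass_points \<mu>)\<close> on, definiteness fails.\<close>

lemma ip_definite: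
  assumes "ip p p = 0" "degree p < card (mass_points \<mu>)"
  shows "p = 0"
proof (rule ccontr)
  assume "p \<noteq> 0"
  then have "card {z. poly p z = 0} \<le> degree p"
    by (rule card_poly_roots_bound)
  moreover have "card (mass_points \<mu>) \<le> card {z. poly p z = 0}"
    using assms \<open>p \<noteq> 0\<close> by (intro card_mono poly_roots_finite) (auto simp: ip_self_eq_0_iff)
  ultimately show False
    using assms by simp
qed

lemma ip_self_pos:
  assumes "p \<noteq> 0" "degree p < card (mass_points \<mu>)"
  shows "0 < Re (ip p p)"
  using ip_self_nonneg[of p] ip_definite[OF _ assms(2)] assms(1) ip_self[of p]
  by (metis Re_complex_of_real of_real_0 order_le_less)

section \<open>Monic orthogonal polynomials and Szego's recursion\<close>

definition is_OP :: "nat \<Rightarrow> complex poly \<Rightarrow> bool" where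
  "is_OP k p \<longleftrightarrow> degree p = k \<and> lead_coeff p = 1 \<and> (\<forall>q. degree q < k \<longrightarrow> ip q p = 0)"

text \<open>Two candidates differ by a polynomial of degree below \<open>k\<close> that is
  orthogonal to itself. Definiteness is used only for this difference, so
  \<open>k = card (mass_points \<mu>)\<close> is allowed although the polynomial then has norm
  zero.\<close>

lemma is_OP_unique:
  assumes p: "is_OP k p" and q: "is_OP k q" and k: "k \<le> card (mass_points \<mu>)"
  shows "p = q"
proof (rule ccontr)
  assume "p \<noteq> q"
  then have "degree (p - q) < k"
    using monic_diff_degree[of q p k] p q by (auto simp: is_OP_def)
  moreover then have "ip (p - q) (p - q) = 0"
    using p q unfolding ip_diff_right by (simp add: is_OP_def)
  ultimately show False
    using ip_definite[of "p - q"] k \<open>p \<noteq> q\<close> by simp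
qed

text \<open>The two polynomials share their leading term, and \<open>p\<close> annihilates the rest.
  With \<open>monom 1 k\<close> this yields the nonzero denominator in \<open>szego_step\<close>;
  with \<open>z\<close> times the preceding orthogonal polynomial, the subdiagonal of the
  multiplication matrix.\<close>

lemma is_OP_ip_self:
  assumes p: "is_OP k p" and q: "degree q = k" "lead_coeff q = 1"
  shows "ip q p = ip p p"
proof (cases "p = q")
  case False
  then have "degree (q - p) < k"
    using monic_diff_degree[of p q k] p q by (auto simp: is_OP_def)
  then have "ip (q - p) p = 0"
    using p by (simp add: is_OP_def)
  then show ?thesis
    by (simp add: ip_diff_left)
qed simp

text \<open>\<open>szego_rev\<close> supplies only values away from \<open>0\<close>; a genuine
  polynomial is needed for degree and orthogonality arguments. The degree drops if a nonzero
  \<open>p\<close> vanishes at \<open>0\<close>, hence the inequality in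
  \<open>degree_rev_poly_le\<close>.\<close>

definition rev_poly :: "complex poly \<Rightarrow> complex poly" where
  "rev_poly p = reflect_poly (map_poly cnj p)"

lemma poly_rev_poly:
  assumes "z \<noteq> 0" shows "poly (rev_poly p) z = z ^ degree p * cnj (poly p (1 / cnj z))"
proof -
  have "poly (map_poly cnj p) (inverse z) = cnj (poly p (1 / cnj z))"
    by (subst poly_cnj) (simp add: inverse_eq_divide)
  moreover have "degree (map_poly cnj p) = degree p"
    by (rule degree_map_poly) simp
  ultimately show ?thesis
    unfolding rev_poly_def poly_reflect_poly_nz[OF assms] by (simp only:)
qed

lemma degree_rev_poly_le: "degree (rev_poly p) \<le> degree p"
  unfolding rev_poly_def
  by (rule order_trans[OF degree_reflect_poly_le]) (simp add: map_poly_degree_leq)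

lemma poly_rev_poly_mass:
  assumes "z \<in> mass_points \<mu>"
  shows "poly (rev_poly p) z = z ^ degree p * cnj (poly p z)"
  using poly_rev_poly[of z p] mass_cnj[OF assms] by simp

text \<open>On the circle \<open>cnj z\<close> is the inverse of \<open>z\<close>, so reversal
  reflects exponents: orthogonality of \<open>p\<close> to low powers becomes orthogonality of its
  reversal to high powers.\<close>

lemma ip_monom_rev_poly:
  assumes "j \<le> degree p"
  shows "ip (monom 1 j) (rev_poly p) = cnj (ip (monom 1 (degree p - j)) p)"
proof -
  have "cnj (z ^ j) * (z ^ degree p * a) = z ^ (degree p - j) * a" if "z \<in> mass_points \<mu>" for z a
  proof -
    obtain m where m: "degree p = j + m"
      using assms le_Suc_ex by blast
    have "cnj (z ^ j) * (z ^ degree p * a) = (cnj z * z) ^ j * (z ^ (degree p - j) * a)"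
      unfolding m by (simp add: power_add power_mult_distrib)
    then show ?thesis
      using mass_cnj(3)[OF that] by simp
  qed
  then show ?thesis
    unfolding ip_eq cnj_sum by (intro sum.cong refl) (simp add: poly_rev_poly_mass poly_monom)
qed

lemma is_OP_monomI:
  assumes "degree p = k" "lead_coeff p = 1" "\<And>j. j < k \<Longrightarrow> ip (monom 1 j) p = 0"
  shows "is_OP k p"
  unfolding is_OP_def
proof (intro conjI allI impI)
  fix q :: "complex poly" assume q: "degree q < k"
  have "ip q p = ip (\<Sum>i\<le>degree q. smult (coeff q i) (monom 1 i)) p"
    by (simp add: smult_monom poly_as_sum_of_monoms)
  also have "\<dots> = 0"
    using q assms by (simp add: ip_sum_left ip_smult_left)
  finally show "ip q p = 0" .
qed (use assms in auto)

text \<open>The Verblunsky coefficient is forced by orthogonality to the constants: both \<open>z \<Phi>\<^sub>k\<close> and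
  the reversed polynomial are already orthogonal to \<open>z, \<dots>, z\<^sup>k\<close>.\<close>

lemma szego_step:
  assumes p: "is_OP k p" and k: "k < card (mass_points \<mu>)"
  obtains a where "is_OP (Suc k) ([:0, 1:] * p - smult (cnj a) (rev_poly p))"
proof -
  have dp: "degree p = k" and lp: "lead_coeff p = 1"
    using p by (auto simp: is_OP_def)
  have "p \<noteq> 0"
    using lp by auto
  have zero: "ip (monom 1 j) p = 0" if "j < k" for j
    using p that by (simp add: is_OP_def degree_monom_eq)
  have c: "ip (monom 1 0) (rev_poly p) \<noteq> 0"
  proof -
    have "ip (monom 1 0) (rev_poly p) = cnj (ip p p)"
      using is_OP_ip_self[OF p, of "monom 1 k"] ip_monom_rev_poly[of 0 p] dp by (simp add: degree_monom_eq)
    then show ?thesis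
      using ip_self_pos[OF \<open>p \<noteq> 0\<close>] dp k by (metis complex_cnj_zero_iff less_irrefl zero_complex.sel(1))
  qed
  define b where "b = ip (monom 1 0) ([:0, 1:] * p) / ip (monom 1 0) (rev_poly p)"
  let ?q = "[:0, 1:] * p - smult b (rev_poly p)"
  have dz: "degree ([:0, 1:] * p) = Suc k"
    using \<open>p \<noteq> 0\<close> dp by simp
  have dr: "degree (smult b (rev_poly p)) < Suc k"
    using degree_rev_poly_le[of p] degree_smult_le[of b "rev_poly p"] dp by linarith
  have "degree ?q = Suc k"
    using dz dr by (metis diff_conv_add_uminus degree_add_eq_left degree_minus)
  moreover have "coeff ?q (Suc k) = 1"
    using coeff_eq_0[OF dr] lp dp by simp
  moreover have "ip (monom 1 j) ?q = 0" if "j < Suc k" for j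
  proof (cases j)
    case 0
    then show ?thesis
      using c by (simp add: ip_diff_right ip_smult_right b_def)
  next
    case (Suc i)
    have "ip (monom 1 j) ([:0, 1:] * p) = ip (monom 1 i) p"
      using ip_mult_z[of "monom 1 i" p] by (simp add: Suc monom_Suc)
    then show ?thesis
      using ip_monom_rev_poly[of j p] zero[of i] zero[of "k - j"] that Suc dp
      by (simp add: ip_diff_right ip_smult_right)
  qed
  ultimately have "is_OP (Suc k) ?q"
    by (intro is_OP_monomI) auto
  then show ?thesis
    using that[of "cnj b"] by simp
qed

lemma is_OP_exists: "k \<le> card (mass_points \<mu>) \<Longrightarrow> \<exists>p. is_OP k p"
proof (induction k)
  case 0
  have "is_OP 0 1"
    by (simp add: is_OP_def)
  then show ?case
    by blast
next
  case (Suc k)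
  then show ?case
    by (metis Suc_leD Suc_le_lessD szego_step)
qed

lemma is_OP_prod: "is_OP (card (mass_points \<mu>)) (\<Prod>w\<in>mass_points \<mu>. [:- w, 1:])"
proof -
  let ?P = "\<Prod>w\<in>mass_points \<mu>. [:- w, 1:]"
  have "poly ?P z = 0" if "z \<in> mass_points \<mu>" for z
    using that finite_mass by (simp add: poly_prod)
  then have "ip q ?P = 0" for q
    by (simp add: ip_eq)
  moreover have "degree ?P = card (mass_points \<mu>)"
    by (simp add: degree_prod_eq_sum_degree)
  moreover have "lead_coeff ?P = 1"
    by (simp add: lead_coeff_prod)
  ultimately show ?thesis
    by (simp add: is_OP_def)
qed

lemma monic_OP_is_OP:
  assumes "k \<le> card (mass_points \<mu>)"
  shows "is_OP k (monic_OP \<mu> k)"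
proof (cases "k < card (mass_points \<mu>)")
  case True
  have "\<exists>!p. is_OP k p"
    using is_OP_exists[OF assms] is_OP_unique[OF _ _ assms] by blast
  from theI'[OF this] have "is_OP k (THE p. is_OP k p)" .
  moreover have "monic_OP \<mu> k = (THE p. is_OP k p)"
    using True by (simp add: monic_OP_def is_OP_def ip_def cong: conj_cong)
  ultimately show ?thesis
    by simp
next
  case False
  then show ?thesis
    using assms is_OP_prod by (simp add: monic_OP_def)
qed

lemma szego_recursion:
  assumes k: "k < card (mass_points \<mu>)" and z: "z \<noteq> 0"
  shows "poly (monic_OP \<mu> (Suc k)) z
    = z * poly (monic_OP \<mu> k) z - cnj (verblunsky \<mu> k) * szego_rev \<mu> k z"
proof -
  let ?p = "monic_OP \<mu> k"
  have p: "is_OP k ?p" and p': "is_OP (Suc k) (monic_OP \<mu> (Suc k))"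
    using k by (auto intro: monic_OP_is_OP)
  have dp: "degree ?p = k" and lp: "lead_coeff ?p = 1"
    using p by (auto simp: is_OP_def)
  have rev: "szego_rev \<mu> k z = poly (rev_poly ?p) z" if "z \<noteq> 0" for z
    using poly_rev_poly[OF that] dp by (simp add: szego_rev_def)
  obtain a where "is_OP (Suc k) ([:0, 1:] * ?p - smult (cnj a) (rev_poly ?p))"
    using szego_step[OF p k] .
  then have a: "monic_OP \<mu> (Suc k) = [:0, 1:] * ?p - smult (cnj a) (rev_poly ?p)"
    using is_OP_unique[OF p'] k by simp
  have "?p \<noteq> 0"
    using lp by auto
  \<comment> \<open>At a mass point a polynomial and its reversal have equal modulus, so the
    reversal is nonzero at \<open>w\<close> too. Comparing the recursion at this one point
    determines the coefficient.\<close>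
  then obtain w where w: "w \<in> mass_points \<mu>" "poly ?p w \<noteq> 0"
    using ip_definite[of ?p] k dp by (auto simp: ip_self_eq_0_iff)
  have w0: "w \<noteq> 0" and "szego_rev \<mu> k w \<noteq> 0"
    using w mass_cnj[OF w(1)] by (simp_all add: rev poly_rev_poly_mass)
  have rec: "poly (monic_OP \<mu> (Suc k)) z = z * poly ?p z - cnj a * szego_rev \<mu> k z" if "z \<noteq> 0" for z
    using rev[OF that] by (simp add: a)
  have "verblunsky \<mu> k = a"
    unfolding verblunsky_def
  proof (rule the_equality)
    fix b
    assume "\<forall>z. z \<noteq> 0 \<longrightarrow> poly (monic_OP \<mu> (Suc k)) z = z * poly ?p z - cnj b * szego_rev \<mu> k z"
    with w0 rec[OF w0] have "cnj b * szego_rev \<mu> k w = cnj a * szego_rev \<mu> k w"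
      by simp
    with \<open>szego_rev \<mu> k w \<noteq> 0\<close> show "b = a"
      by simp
  qed (use rec in blast)
  with rec[OF z] show ?thesis
    by simp
qed

section \<open>Reconstruction of the measure from its Verblunsky coefficients\<close>

lemma mass_points_eq_roots: "mass_points \<mu> = {z. poly (monic_OP \<mu> (card (mass_points \<mu>))) z = 0}"
  using finite_mass by (auto simp: monic_OP_def poly_prod)

text \<open>Being orthogonal to \<open>1\<close>, an orthogonal polynomial of positive degree
  integrates to zero under both measures. Subtracting the right multiple of it lowers the degree of
  \<open>q\<close> and changes neither integral.\<close>

lemma poly_integral_cong:
  assumes \<nu>: "circle_measure \<nu>" and OP: "\<And>k. k < n \<Longrightarrow> monic_OP \<mu> k = monic_OP \<nu> k"
    and n: "n = card (mass_points \<mu>)" "n = card (mass_points \<nu>)"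
  shows "degree q < n \<Longrightarrow> (\<integral>z. poly q z \<partial>\<mu>) = (\<integral>z. poly q z \<partial>\<nu>)"
proof -
  interpret \<nu>: circle_measure \<nu> by fact
  have one: "(\<integral>z. poly q z \<partial>\<mu>) = ip 1 q" "(\<integral>z. poly q z \<partial>\<nu>) = \<nu>.ip 1 q" for q
    by (simp_all add: ip_def \<nu>.ip_def L2_inner_def)
  show "degree q < n \<Longrightarrow> (\<integral>z. poly q z \<partial>\<mu>) = (\<integral>z. poly q z \<partial>\<nu>)"
    unfolding one
  proof (induction "degree q" arbitrary: q rule: less_induct)
    case less
    let ?d = "degree q"
    show ?case
    proof (cases "?d = 0")
      case True
      then obtain c where "q = [:c:]" by (rule degree_eq_zeroE)
      then show ?thesis
        by (simp add: ip_def \<nu>.ip_def L2_inner_def prob_space \<nu>.prob_space)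
    next
      case False
      define P where "P = monic_OP \<mu> ?d"
      have P: "is_OP ?d P" "\<nu>.is_OP ?d P"
        using less.prems n OP[of ?d] monic_OP_is_OP[of ?d] \<nu>.monic_OP_is_OP[of ?d] by (simp_all add: P_def)
      have dP: "degree P = ?d" "lead_coeff P = 1" using P by (auto simp: is_OP_def)
      have zero: "ip 1 P = 0" "\<nu>.ip 1 P = 0"
        using P False by (auto simp: is_OP_def \<nu>.is_OP_def)
      define r where "r = q - smult (lead_coeff q) P"
      have q: "q = r + smult (lead_coeff q) P" by (simp add: r_def)
      have r: "degree r < ?d"
        unfolding r_def
      proof (cases "q = smult (lead_coeff q) P")
        case False
        then show "degree (q - smult (lead_coeff q) P) < degree q"
          using dP by (intro monic_diff_degree) auto
      qed (use False in simp)
      have "ip 1 r = \<nu>.ip 1 r" using less.hyps[OF r] r less.prems by simp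
      then show ?thesis
        by (subst (1 2) q) (simp only: ip_add_right \<nu>.ip_add_right ip_smult_right \<nu>.ip_smult_right zero)
    qed
  qed
qed

text \<open>Both families start at \<open>1\<close> and obey the same recursion, so they agree up to
  index \<open>n\<close>. The polynomial of index \<open>n\<close> gives the common support, the
  earlier ones the integrals that fix the masses.\<close>

lemma verblunsky_inject:
  assumes \<nu>: "circle_measure \<nu>" and n: "n = card (mass_points \<mu>)" "n = card (mass_points \<nu>)"
    and eq: "\<And>k. k < n \<Longrightarrow> verblunsky \<mu> k = verblunsky \<nu> k"
  shows "\<mu> = \<nu>"
proof -
  interpret \<nu>: circle_measure \<nu> by fact
  have OP: "monic_OP \<mu> k = monic_OP \<nu> k" if "k \<le> n" for k
    using that
  proof (induction k)
    case 0
    have "is_OP 0 1" "\<nu>.is_OP 0 1" by (simp_all add: is_OP_def \<nu>.is_OP_def)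
    then show ?case
      using is_OP_unique[of 0 1 "monic_OP \<mu> 0"] \<nu>.is_OP_unique[of 0 1 "monic_OP \<nu> 0"]
        monic_OP_is_OP[of 0] \<nu>.monic_OP_is_OP[of 0] by simp
  next
    case (Suc k)
    have eqz: "poly (monic_OP \<mu> (Suc k)) z = poly (monic_OP \<nu> (Suc k)) z" if "z \<noteq> 0" for z
      using Suc szego_recursion[of k z] \<nu>.szego_recursion[of k z] that n eq[of k]
      by (simp add: szego_rev_def)
    \<comment> \<open>The recursion is available only for \<open>z \<noteq> 0\<close>, but
      infinitely many common values identify the polynomials.\<close>
    have "monic_OP \<mu> (Suc k) - monic_OP \<nu> (Suc k) = 0"
    proof (rule ccontr)
      assume "monic_OP \<mu> (Suc k) - monic_OP \<nu> (Suc k) \<noteq> 0"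
      then have "finite {z. poly (monic_OP \<mu> (Suc k) - monic_OP \<nu> (Suc k)) z = 0}"
        by (rule poly_roots_finite)
      moreover have "UNIV - {0} \<subseteq> {z. poly (monic_OP \<mu> (Suc k) - monic_OP \<nu> (Suc k)) z = 0}"
        using eqz by auto
      ultimately have "finite (UNIV - {0 :: complex})" by (rule finite_subset[rotated])
      then show False using infinite_UNIV_char_0 by auto
    qed
    then show ?case by simp
  qed
  have "mass_points \<mu> = mass_points \<nu>"
    using mass_points_eq_roots \<nu>.mass_points_eq_roots OP[of n] n by simp
  then show ?thesis
    using n OP AE_mass \<nu>.AE_mass finite_mass sets_eq \<nu>.sets_eq
      finite_measure_axioms \<nu>.finite_measure_axioms poly_integral_cong[OF \<nu> _ n]
    by (intro finite_measure_eqI_poly[of \<mu> "mass_points \<mu>" \<nu>]) auto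
qed

lemma measure_of_verblunsky_eq:
  assumes "n = card (mass_points \<mu>)"
  shows "measure_of_verblunsky n (verblunsky \<mu>) = \<mu>"
  unfolding measure_of_verblunsky_def
proof (rule the_equality)
  show "circle_prob \<mu> \<and> supported_at n \<mu> \<and> (\<forall>k<n. verblunsky \<mu> k = verblunsky \<mu> k)"
    using circle finite_mass AE_mass assms by (simp add: supported_at_def)
next
  fix \<nu> assume \<nu>: "circle_prob \<nu> \<and> supported_at n \<nu> \<and> (\<forall>k<n. verblunsky \<nu> k = verblunsky \<mu> k)"
  then have "circle_measure \<nu>" "n = card (mass_points \<nu>)"
    by (auto simp: circle_measure_def supported_at_def)
  from verblunsky_inject[OF this(1) assms this(2)] \<nu> show "\<nu> = \<mu>" by simp
qed

section \<open>Orthonormal polynomials and the matrix of multiplication by z\<close>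

definition OP_norm :: "nat \<Rightarrow> real" where
  "OP_norm k = L2_norm \<mu> (poly (monic_OP \<mu> k))"

definition ON_poly :: "nat \<Rightarrow> complex poly" where
  "ON_poly k = smult (of_real (1 / OP_norm k)) (monic_OP \<mu> k)"

lemma orthonormal_OP_eq: "orthonormal_OP \<mu> k z = poly (ON_poly k) z"
  by (simp add: orthonormal_OP_def ON_poly_def OP_norm_def)

lemma degree_monic_OP: "k \<le> card (mass_points \<mu>) \<Longrightarrow> degree (monic_OP \<mu> k) = k"
  and lead_coeff_monic_OP: "k \<le> card (mass_points \<mu>) \<Longrightarrow> lead_coeff (monic_OP \<mu> k) = 1"
  and ip_monic_OP: "k \<le> card (mass_points \<mu>) \<Longrightarrow> degree q < k \<Longrightarrow> ip q (monic_OP \<mu> k) = 0"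
  and monic_OP_nonzero: "k \<le> card (mass_points \<mu>) \<Longrightarrow> monic_OP \<mu> k \<noteq> 0"
  using monic_OP_is_OP[of k] by (auto simp: is_OP_def)

lemma OP_norm_pos: "k < card (mass_points \<mu>) \<Longrightarrow> OP_norm k > 0"
  using ip_self_pos[of "monic_OP \<mu> k"] degree_monic_OP[of k] monic_OP_nonzero[of k]
  by (simp add: OP_norm_def L2_norm_def ip_def)

lemma ip_monic_OP_self: "ip (monic_OP \<mu> k) (monic_OP \<mu> k) = of_real ((OP_norm k)\<^sup>2)"
proof -
  have "(OP_norm k)\<^sup>2 = Re (ip (monic_OP \<mu> k) (monic_OP \<mu> k))"
    using ip_self_nonneg[of "monic_OP \<mu> k"] by (simp add: OP_norm_def L2_norm_def ip_def)
  then show ?thesis by (metis Re_complex_of_real ip_self)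
qed

lemma degree_ON_poly: "k < card (mass_points \<mu>) \<Longrightarrow> degree (ON_poly k) = k"
  using OP_norm_pos[of k] degree_monic_OP[of k] by (simp add: ON_poly_def)

lemma ip_ON_poly_lower:
  assumes "k < card (mass_points \<mu>)" "degree q < k"
  shows "ip q (ON_poly k) = 0" "ip (ON_poly k) q = 0"
proof -
  show "ip q (ON_poly k) = 0" using assms by (simp add: ON_poly_def ip_smult_right ip_monic_OP)
  then show "ip (ON_poly k) q = 0" using ip_cnj by (metis complex_cnj_zero)
qed

lemma ip_ON_poly:
  assumes "i < card (mass_points \<mu>)" "j < card (mass_points \<mu>)"
  shows "ip (ON_poly i) (ON_poly j) = (if i = j then 1 else 0)"
proof (rule linorder_cases[of i j])
  assume "i = j"
  then show ?thesis using OP_norm_pos[OF assms(1)]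
    by (simp add: ON_poly_def ip_smult_left ip_smult_right ip_monic_OP_self power2_eq_square flip: of_real_mult)
qed (use assms in \<open>simp_all add: ip_ON_poly_lower degree_ON_poly\<close>)

text \<open>A nonzero remainder \<open>r\<close> of degree \<open>d\<close>, made monic, would pair
  with \<open>monic_OP \<mu> d\<close> to the positive squared norm of the latter; by construction
  \<open>r\<close> is orthogonal to it.\<close>

lemma ON_poly_expansion:
  assumes q: "degree q < card (mass_points \<mu>)"
  shows "q = (\<Sum>i<card (mass_points \<mu>). smult (ip (ON_poly i) q) (ON_poly i))"
proof (rule ccontr)
  let ?n = "card (mass_points \<mu>)"
  let ?s = "\<Sum>i<?n. smult (ip (ON_poly i) q) (ON_poly i)"
  define r where "r = q - ?s"
  assume "q \<noteq> ?s"
  then have "r \<noteq> 0" by (simp add: r_def)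
  have "degree ?s < ?n"
    using q by (intro degree_sum_less) (auto simp: degree_ON_poly intro: le_less_trans[OF degree_smult_le])
  then have d: "degree r < ?n" using q by (simp add: r_def degree_diff_less)
  define d where "d = degree r"
  have "ip (ON_poly d) ?s = (\<Sum>i<?n. if i = d then ip (ON_poly i) q else 0)"
    unfolding ip_sum_right using d by (intro sum.cong refl) (auto simp: ip_smult_right ip_ON_poly d_def)
  then have "ip (ON_poly d) r = 0"
    using d by (simp add: r_def ip_diff_right d_def)
  then have "ip (monic_OP \<mu> d) r = 0"
    using OP_norm_pos[OF d] by (simp add: ON_poly_def ip_smult_left d_def)
  then have "ip r (monic_OP \<mu> d) = 0" by (metis complex_cnj_zero ip_cnj)
  moreover have "ip (smult (1 / lead_coeff r) r) (monic_OP \<mu> d) = ip (monic_OP \<mu> d) (monic_OP \<mu> d)"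
    using d \<open>r \<noteq> 0\<close> by (intro is_OP_ip_self[of d] monic_OP_is_OP) (simp_all add: d_def)
  ultimately have "ip (monic_OP \<mu> d) (monic_OP \<mu> d) = 0" by (simp add: ip_smult_left)
  then show False using OP_norm_pos[OF d] by (simp add: ip_monic_OP_self d_def)
qed

lemma ip_cong_mass:
  assumes "\<And>z. z \<in> mass_points \<mu> \<Longrightarrow> poly q z = poly r z"
  shows "ip p q = ip p r"
  unfolding ip_eq using assms by (intro sum.cong refl) simp

text \<open>A polynomial of any degree is reduced modulo the polynomial vanishing on the mass
  points. The price is that the identity holds at these points only.\<close>

lemma ON_poly_expansion_mass:
  assumes "z \<in> mass_points \<mu>"
  shows "poly q z = (\<Sum>i<card (mass_points \<mu>). ip (ON_poly i) q * poly (ON_poly i) z)"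
proof -
  let ?n = "card (mass_points \<mu>)"
  define r where "r = q mod monic_OP \<mu> ?n"
  have eq: "poly q z = poly r z" if "z \<in> mass_points \<mu>" for z
  proof -
    have "poly (monic_OP \<mu> ?n) z = 0" using that mass_points_eq_roots by auto
    then show ?thesis unfolding r_def by (rule poly_mod[symmetric])
  qed
  have "card (mass_points \<mu>) > 0" using assms finite_mass by (auto simp: card_gt_0_iff)
  then have "degree r < ?n"
    using degree_mod_less'[of "monic_OP \<mu> ?n" q] degree_monic_OP[of ?n] monic_OP_nonzero[of ?n]
    by (cases "r = 0") (auto simp: r_def)
  then have "poly r z = poly (\<Sum>i<?n. smult (ip (ON_poly i) r) (ON_poly i)) z"
    using ON_poly_expansion by simp
  also have "\<dots> = (\<Sum>i<?n. ip (ON_poly i) q * poly (ON_poly i) z)"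
    using ip_cong_mass[of r q, OF eq[symmetric]] by (simp add: poly_sum)
  finally show ?thesis using eq[OF assms] by simp
qed

definition mult_entry :: "nat \<Rightarrow> nat \<Rightarrow> complex" where
  "mult_entry i j = ip (ON_poly i) ([:0, 1:] * ON_poly j)"

lemma mult_matrix_eq:
  assumes n: "n = card (mass_points \<mu>)"
  shows "mult_matrix n \<mu> = mat n n (\<lambda>(i, j). mult_entry i j)"
  unfolding mult_matrix_def
proof (rule the_equality, goal_cases)
  case 1
  show ?case
  proof (intro conjI allI impI)
    fix j assume j: "j < n"
    show "AE z in \<mu>. z * orthonormal_OP \<mu> j z =
        (\<Sum>i<n. index_mat (mat n n (\<lambda>(i, j). mult_entry i j)) (i, j) * orthonormal_OP \<mu> i z)"
      unfolding AE_iff_mass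
      using j ON_poly_expansion_mass[of _ "[:0, 1:] * ON_poly j"]
      by (simp add: orthonormal_OP_eq mult_entry_def n)
  qed simp
next
  case (2 G)
  then have G: "G \<in> carrier_mat n n" and eq: "j < n \<Longrightarrow> z \<in> mass_points \<mu> \<Longrightarrow>
      z * poly (ON_poly j) z = (\<Sum>i<n. index_mat G (i, j) * poly (ON_poly i) z)" for j z
    by (auto simp: AE_iff_mass orthonormal_OP_eq)
  show ?case
  proof (rule eq_matI)
    fix i j assume "i < dim_row (mat n n (\<lambda>(i, j). mult_entry i j))" "j < dim_col (mat n n (\<lambda>(i, j). mult_entry i j))"
    then have ij: "i < n" "j < n" by auto
    have "mult_entry i j = ip (ON_poly i) (\<Sum>k<n. smult (index_mat G (k, j)) (ON_poly k))"
      unfolding mult_entry_def by (rule ip_cong_mass) (simp add: eq[OF ij(2)] poly_sum)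
    also have "\<dots> = (\<Sum>k<n. if k = i then index_mat G (k, j) else 0)"
      unfolding ip_sum_right using ij n by (intro sum.cong refl) (auto simp: ip_smult_right ip_ON_poly)
    also have "\<dots> = index_mat G (i, j)" using ij by simp
    finally show "index_mat G (i, j) = index_mat (mat n n (\<lambda>(i, j). mult_entry i j)) (i, j)"
      using ij by simp
  qed (use G in auto)
qed

text \<open>The Hessenberg shape: multiplication by \<open>z\<close> raises the degree by only
  one.\<close>

lemma mult_entry_eq_0:
  assumes "Suc j < i" "i < card (mass_points \<mu>)"
  shows "mult_entry i j = 0"
proof -
  have "degree ([:0, 1:] * ON_poly j) \<le> 1 + j"
    using degree_mult_le[of "[:0, 1:]" "ON_poly j"] degree_ON_poly[of j] assms by simp
  then show ?thesis unfolding mult_entry_def using assms by (intro ip_ON_poly_lower) auto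
qed

text \<open>\<open>z\<close> times \<open>monic_OP \<mu> j\<close> has the leading term of
  \<open>monic_OP \<mu> (Suc j)\<close>, so they pair to the squared norm of the latter; normalising
  divides by both norms. This ratio becomes the \<open>\<rho>\<close> of the factor
  \<open>Xi\<close>.\<close>

lemma mult_entry_Suc:
  assumes "Suc j < card (mass_points \<mu>)"
  shows "mult_entry (Suc j) j = of_real (OP_norm (Suc j) / OP_norm j)"
proof -
  let ?q = "[:0, 1:] * monic_OP \<mu> j"
  have j: "j \<le> card (mass_points \<mu>)" "Suc j \<le> card (mass_points \<mu>)" using assms by auto
  have "ip ?q (monic_OP \<mu> (Suc j)) = ip (monic_OP \<mu> (Suc j)) (monic_OP \<mu> (Suc j))"
    using degree_monic_OP[OF j(1)] lead_coeff_monic_OP[OF j(1)] monic_OP_nonzero[OF j(1)]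
    by (intro is_OP_ip_self[OF monic_OP_is_OP[OF j(2)]]) simp_all
  then have "ip (monic_OP \<mu> (Suc j)) ?q = of_real ((OP_norm (Suc j))\<^sup>2)"
    using ip_cnj[of ?q "monic_OP \<mu> (Suc j)"] by (simp add: ip_monic_OP_self)
  moreover have "[:0, 1:] * ON_poly j = smult (of_real (1 / OP_norm j)) ?q"
    unfolding ON_poly_def by (rule mult_smult_right)
  ultimately have "mult_entry (Suc j) j = of_real (1 / OP_norm (Suc j)) * (of_real (1 / OP_norm j) * of_real ((OP_norm (Suc j))\<^sup>2))"
    unfolding mult_entry_def ON_poly_def[of "Suc j"] by (simp only: ip_smult_left ip_smult_right complex_cnj_complex_of_real mult.left_commute)
  then show ?thesis
    using OP_norm_pos[OF assms] by (simp add: power2_eq_square)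
qed

text \<open>Before the last column the product with \<open>z\<close> still has degree below the
  number of mass points, so the expansion is an identity of polynomials. It may therefore be
  evaluated at \<open>1\<close>, whether or not \<open>1\<close> is a mass point.\<close>

lemma sum_mult_entry:
  assumes "Suc j < card (mass_points \<mu>)"
  shows "(\<Sum>i<card (mass_points \<mu>). mult_entry i j * poly (ON_poly i) z) = z * poly (ON_poly j) z"
proof -
  let ?q = "[:0, 1:] * ON_poly j"
  have "degree ?q \<le> 1 + j"
    using degree_mult_le[of "[:0, 1:]" "ON_poly j"] degree_ON_poly[of j] assms by simp
  then have "poly ?q z = poly (\<Sum>i<card (mass_points \<mu>). smult (ip (ON_poly i) ?q) (ON_poly i)) z"
    using assms by (subst ON_poly_expansion[symmetric]) auto
  then show ?thesis by (simp add: mult_entry_def poly_sum del: mult_pCons_left)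
qed

text \<open>Here the degree reaches the number of mass points. The multiple \<open>?P\<close> of the
  vanishing polynomial cancels the leading term; it is orthogonal to every basis polynomial and
  leaves the coefficients alone, but its value off the mass points appears as a correction.\<close>

lemma sum_mult_entry_last:
  assumes "Suc j = card (mass_points \<mu>)"
  shows "(\<Sum>i<card (mass_points \<mu>). mult_entry i j * poly (ON_poly i) z)
    = z * poly (ON_poly j) z - poly (monic_OP \<mu> (Suc j)) z / of_real (OP_norm j)"
proof -
  let ?P = "smult (of_real (1 / OP_norm j)) (monic_OP \<mu> (Suc j))"
  let ?q = "[:0, 1:] * ON_poly j - ?P"
  have j: "j < card (mass_points \<mu>)" "j \<le> card (mass_points \<mu>)" "Suc j \<le> card (mass_points \<mu>)" using assms by auto
  have N: "OP_norm j > 0" using j by (simp add: OP_norm_pos)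
  have mj: "coeff (monic_OP \<mu> j) j = 1" "coeff (monic_OP \<mu> (Suc j)) (Suc j) = 1"
    using lead_coeff_monic_OP[OF j(2)] lead_coeff_monic_OP[OF j(3)] degree_monic_OP[OF j(2)] degree_monic_OP[OF j(3)] by simp_all
  have "degree ?q < Suc j"
  proof (cases "?P = [:0, 1:] * ON_poly j")
    case False
    then show ?thesis
    proof (rule monic_diff_degree)
      show "degree ?P = Suc j" using N degree_monic_OP[OF j(3)] by simp
      show "degree ([:0, 1:] * ON_poly j) = Suc j"
        using degree_ON_poly[OF j(1)] N monic_OP_nonzero[OF j(2)] by (simp add: ON_poly_def)
      show "lead_coeff ?P = lead_coeff ([:0, 1:] * ON_poly j)"
        using mj degree_monic_OP[OF j(3)] degree_monic_OP[OF j(2)] N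
          monic_OP_nonzero[OF j(2)] by (simp add: ON_poly_def)
    qed
  qed simp
  then have "poly ?q z = poly (\<Sum>i<card (mass_points \<mu>). smult (ip (ON_poly i) ?q) (ON_poly i)) z"
    using assms by (subst ON_poly_expansion[symmetric]) auto
  moreover have "ip (ON_poly i) ?P = 0" if "i < card (mass_points \<mu>)" for i
    using that j ip_monic_OP[OF j(3), of "ON_poly i"] degree_ON_poly[OF that] assms by (simp add: ip_smult_right)
  ultimately have "poly ?q z = (\<Sum>i<card (mass_points \<mu>). mult_entry i j * poly (ON_poly i) z)"
    unfolding poly_sum mult_entry_def ip_diff_right by (simp del: mult_pCons_left)
  then show ?thesis by simp
qed

section \<open>Determination of a circle measure by its moments\<close>

lemma measurable_powi: "(\<lambda>z :: complex. z powi k) \<in> borel_measurable borel"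
  unfolding power_int_def by measurable

lemma L2_inner_moments:
  assumes \<nu>: "circle_prob \<nu>"
  shows "integrable \<nu> (\<lambda>z. cnj (poly p z) * poly q z)" (is ?int)
    and "L2_inner \<nu> (poly p) (poly q) =
      (\<Sum>i\<le>degree p. \<Sum>j\<le>degree q. cnj (coeff p i) * coeff q j * (\<integral>z. z powi (int j - int i) \<partial>\<nu>))" (is ?eq)
proof -
  interpret \<nu>: prob_space \<nu> using \<nu> by (simp add: circle_prob_def)
  have sets: "sets \<nu> = sets borel" and AE: "AE z in \<nu>. cmod z = 1"
    using \<nu> by (simp_all add: circle_prob_def)
  have meas: "f \<in> borel_measurable \<nu>" if "f \<in> borel_measurable borel" for f :: "complex \<Rightarrow> complex"
    using that measurable_cong_sets[OF sets refl] by blast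
  have mon: "(\<lambda>z :: complex. cnj z ^ i * z ^ j) \<in> borel_measurable \<nu>" for i j
    by (intro meas borel_measurable_continuous_onI continuous_intros)
  have int: "integrable \<nu> (\<lambda>z. cnj z ^ i * z ^ j)" for i j
  proof (rule \<nu>.integrable_const_bound[OF _ mon])
    show "AE z in \<nu>. cmod (cnj z ^ i * z ^ j) \<le> 1"
      using AE by eventually_elim (simp add: norm_mult norm_power)
  qed
  have intg: "(\<integral>z. cnj z ^ i * z ^ j \<partial>\<nu>) = (\<integral>z. z powi (int j - int i) \<partial>\<nu>)" for i j
  proof (rule integral_cong_AE[OF mon meas[OF measurable_powi]])
    have pt: "cnj z ^ i * z ^ j = z powi (int j - int i)" if z: "cmod z = 1" for z
    proof -
      have "z \<noteq> 0" using z by auto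
      moreover have "cnj z = inverse z"
        using z complex_norm_square[of z] \<open>z \<noteq> 0\<close> by (simp add: field_simps)
      ultimately show ?thesis
        by (simp add: power_int_diff divide_inverse power_inverse)
    qed
    show "AE z in \<nu>. cnj z ^ i * z ^ j = z powi (int j - int i)"
      using AE by eventually_elim (rule pt)
  qed
  have expand: "cnj (poly p z) * poly q z =
      (\<Sum>i\<le>degree p. \<Sum>j\<le>degree q. cnj (coeff p i) * coeff q j * (cnj z ^ i * z ^ j))" for z
    unfolding poly_altdef cnj_sum sum_product by (simp add: mult_ac)
  show ?int unfolding expand by (intro Bochner_Integration.integrable_sum integrable_mult_right int)
  show ?eq
    unfolding L2_inner_def expand
    by (simp add: Bochner_Integration.integral_sum int intg)
qed

text \<open>Equal moments give equal inner products of polynomials. Hence \<open>P\<close>, whose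
  zeros are exactly the mass points of \<open>\<mu>\<close>, has norm zero for \<open>\<nu>\<close>
  as well; this confines \<open>\<nu>\<close> to the same finite set, where interpolation
  decides.\<close>

lemma moments_inject:
  assumes \<nu>: "circle_prob \<nu>" and eq: "\<And>k. (\<integral>z. z powi k \<partial>\<nu>) = (\<integral>z. z powi k \<partial>\<mu>)"
  shows "\<nu> = \<mu>"
proof -
  interpret \<nu>: prob_space \<nu> using \<nu> by (simp add: circle_prob_def)
  have sets: "sets \<nu> = sets borel" using \<nu> by (simp add: circle_prob_def)
  have L2: "L2_inner \<nu> (poly p) (poly q) = ip p q" for p q
    unfolding ip_def L2_inner_moments(2)[OF \<nu>] L2_inner_moments(2)[OF circle] eq ..
  define P where "P = monic_OP \<mu> (card (mass_points \<mu>))"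
  have root: "poly P z = 0 \<longleftrightarrow> z \<in> mass_points \<mu>" for z
    unfolding P_def using mass_points_eq_roots by auto
  then have "ip P P = 0" by (simp add: ip_self_eq_0_iff)
  have sq: "cnj (poly P z) * poly P z = of_real ((cmod (poly P z))\<^sup>2)" for z
    unfolding complex_norm_square by (rule mult.commute)
  have "integrable \<nu> (\<lambda>z. (cmod (poly P z))\<^sup>2)"
    using L2_inner_moments(1)[OF \<nu>, of P P] unfolding sq by (simp only: complex_of_real_integrable_eq)
  moreover have "(\<integral>z. (cmod (poly P z))\<^sup>2 \<partial>\<nu>) = 0"
    using L2[of P P] \<open>ip P P = 0\<close> unfolding L2_inner_def sq integral_complex_of_real by simp
  ultimately have "AE z in \<nu>. (cmod (poly P z))\<^sup>2 = 0"
    by (subst (asm) integral_nonneg_eq_0_iff_AE) auto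
  then have AE: "AE z in \<nu>. z \<in> mass_points \<mu>"
    by eventually_elim (simp add: root)
  have "(\<integral>z. poly q z \<partial>\<nu>) = (\<integral>z. poly q z \<partial>\<mu>)" for q
    using L2[of 1 q] by (simp add: ip_def L2_inner_def)
  then show ?thesis
    by (intro finite_measure_eqI_poly[OF \<nu>.finite_measure_axioms sets AE finite_measure_axioms sets_eq AE_mass finite_mass])
qed

text \<open>One Gram-Schmidt step on the monomials. The right side is recognised by its leading term
  and orthogonality, through uniqueness.\<close>

lemma monic_OP_gram_schmidt:
  assumes k: "k < card (mass_points \<mu>)"
  shows "monic_OP \<mu> k = monom 1 k
    - (\<Sum>i<k. smult (ip (monic_OP \<mu> i) (monom 1 k) / ip (monic_OP \<mu> i) (monic_OP \<mu> i)) (monic_OP \<mu> i))"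
    (is "_ = _ - ?s")
proof -
  let ?n = "card (mass_points \<mu>)"
  have "degree (monom 1 k - ?s) = k \<and> coeff (monom 1 k - ?s) k = 1"
  proof (cases "k = 0")
    case False
    then have s: "degree ?s < k"
      using k by (intro degree_sum_less) (auto simp: degree_monic_OP intro: le_less_trans[OF degree_smult_le])
    then have "degree (monom 1 k - ?s) = k" by (rule degree_monom_diff)
    then show ?thesis using coeff_eq_0[OF s] by simp
  qed simp
  moreover have "ip q (monom 1 k - ?s) = 0" if q: "degree q < k" for q
  proof -
    have zero: "ip (monic_OP \<mu> j) (monom 1 k - ?s) = 0" if j: "j < k" for j
    proof -
      have "ip (monic_OP \<mu> j) ?s = (\<Sum>i<k. if i = j then ip (monic_OP \<mu> j) (monom 1 k) else 0)"
        unfolding ip_sum_right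
      proof (intro sum.cong refl)
        fix i assume "i \<in> {..<k}"
        have "ip (monic_OP \<mu> j) (monic_OP \<mu> i) = 0" if "i \<noteq> j"
          using ip_monic_OP[of i "monic_OP \<mu> j"] ip_monic_OP[of j "monic_OP \<mu> i"] degree_monic_OP[of i] degree_monic_OP[of j]
            \<open>i \<in> {..<k}\<close> j k that ip_cnj[of "monic_OP \<mu> i" "monic_OP \<mu> j"]
          by (cases "i < j") auto
        then show "ip (monic_OP \<mu> j) (smult (ip (monic_OP \<mu> i) (monom 1 k) / ip (monic_OP \<mu> i) (monic_OP \<mu> i)) (monic_OP \<mu> i))
          = (if i = j then ip (monic_OP \<mu> j) (monom 1 k) else 0)"
          using OP_norm_pos[of j] j k by (auto simp: ip_smult_right ip_monic_OP_self)
      qed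
      then show ?thesis using j by (simp add: ip_diff_right)
    qed
    \<comment> \<open>Expand \<open>q\<close> in orthonormal polynomials: the terms below
      \<open>k\<close> are orthogonal by \<open>zero\<close>, and from \<open>k\<close> on the
      coefficients vanish because \<open>degree q < k\<close>.\<close>
    have "ip (smult (ip (ON_poly i) q) (ON_poly i)) (monom 1 k - ?s) = 0" if "i < ?n" for i
    proof (cases "i < k")
      case True
      then show ?thesis using zero[OF True] by (simp add: ON_poly_def ip_smult_left)
    next
      case False
      then show ?thesis using ip_ON_poly_lower(2)[OF that, of q] q by simp
    qed
    then have "ip (\<Sum>i<?n. smult (ip (ON_poly i) q) (ON_poly i)) (monom 1 k - ?s) = 0"
      unfolding ip_sum_left by (intro sum.neutral) simp
    moreover have "degree q < ?n" using q k by simp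
    note arg_cong[OF ON_poly_expansion[OF this], of "\<lambda>p. ip p (monom 1 k - ?s)"]
    ultimately show ?thesis by (rule trans[rotated])
  qed
  ultimately have "is_OP k (monom 1 k - ?s)" by (simp add: is_OP_def)
  then show ?thesis using is_OP_unique[of k] monic_OP_is_OP[of k] k by simp
qed

end

section \<open>Hermitian inner product and unitary matrices\<close>

lemma hinner_eq_sum:
  assumes "x \<in> carrier_vec n" "y \<in> carrier_vec n"
  shows "hinner x y = (\<Sum>i<n. cnj (vec_index x i) * vec_index y i)"
  using assms by (simp add: hinner_def scalar_prod_def lessThan_atLeast0 mult.commute)

lemma
  assumes "x \<in> carrier_vec n" "y \<in> carrier_vec n" "z \<in> carrier_vec n"
  shows hinner_add_right: "hinner x (y + z) = hinner x y + hinner x z"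
    and hinner_diff_right: "hinner x (y - z) = hinner x y - hinner x z"
    and hinner_add_left: "hinner (y + z) x = hinner y x + hinner z x"
    and hinner_diff_left: "hinner (y - z) x = hinner y x - hinner z x"
  using assms by (simp_all add: hinner_eq_sum[of _ n] algebra_simps sum.distrib sum_subtractf)

lemma
  assumes "x \<in> carrier_vec n" "y \<in> carrier_vec n"
  shows hinner_smult_right: "hinner x (c \<cdot>\<^sub>v y) = c * hinner x y"
    and hinner_smult_left: "hinner (c \<cdot>\<^sub>v x) y = cnj c * hinner x y"
    and cnj_hinner: "cnj (hinner x y) = hinner y x"
  using assms by (simp_all add: hinner_eq_sum[of _ n] sum_distrib_left mult_ac)

lemma hinner_self:
  assumes "x \<in> carrier_vec n"
  shows "hinner x x = of_real (\<Sum>i<n. (cmod (vec_index x i))\<^sup>2)"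
  unfolding hinner_eq_sum[OF assms assms] of_real_sum complex_norm_square
  by (simp add: mult.commute)

lemma hinner_self_nonneg: "x \<in> carrier_vec n \<Longrightarrow> 0 \<le> Re (hinner x x)"
  by (simp add: hinner_self sum_nonneg)

lemma hinner_self_eq_0_iff:
  assumes "x \<in> carrier_vec n"
  shows "hinner x x = 0 \<longleftrightarrow> x = 0\<^sub>v n"
  unfolding hinner_self[OF assms] of_real_eq_0_iff
  using assms by (subst sum_nonneg_eq_0_iff) auto

lemma hinner_self_of_real:
  assumes "x \<in> carrier_vec n" shows "hinner x x = of_real (Re (hinner x x))"
  by (simp add: hinner_self[OF assms])

lemma carrier_mat_adjoint [simp]: "A \<in> carrier_mat n m \<Longrightarrow> mat_adjoint A \<in> carrier_mat m n"
  by (auto simp: mat_adjoint_def mat_of_rows_def)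

lemma index_mat_adjoint:
  assumes "A \<in> carrier_mat n m" "i < m" "j < n"
  shows "index_mat (mat_adjoint A) (i, j) = conjugate (index_mat A (j, i))"
  using assms by (simp add: mat_adjoint_def mat_of_rows_def)

lemma mult_mat_vec_index:
  assumes "A \<in> carrier_mat n m" "x \<in> carrier_vec m" "i < n"
  shows "vec_index (A *\<^sub>v x) i = (\<Sum>j<m. index_mat A (i, j) * vec_index x j)"
  using assms by (simp add: scalar_prod_def lessThan_atLeast0)

lemma hinner_mult_mat_vec:
  assumes A: "A \<in> carrier_mat n m" and x: "x \<in> carrier_vec n" and y: "y \<in> carrier_vec m"
  shows "hinner x (A *\<^sub>v y) = hinner (mat_adjoint A *\<^sub>v x) y"
proof -
  note A' = carrier_mat_adjoint[OF A]
  have "hinner x (A *\<^sub>v y) = (\<Sum>i<n. \<Sum>j<m. cnj (vec_index x i) * (index_mat A (i, j) * vec_index y j))"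
    using hinner_eq_sum[OF x mult_mat_vec_carrier[OF A y]]
    by (simp add: mult_mat_vec_index[OF A y] sum_distrib_left del: index_mult_mat_vec)
  also have "\<dots> = (\<Sum>j<m. \<Sum>i<n. cnj (vec_index x i) * (index_mat A (i, j) * vec_index y j))"
    by (rule sum.swap)
  also have "\<dots> = hinner (mat_adjoint A *\<^sub>v x) y"
    using hinner_eq_sum[OF mult_mat_vec_carrier[OF A' x] y]
    by (simp add: mult_mat_vec_index[OF A' x] index_mat_adjoint[OF A] sum_distrib_left mult_ac del: index_mult_mat_vec)
  finally show ?thesis .
qed

lemma mat_adjoint_adjoint:
  assumes "A \<in> carrier_mat n m" shows "mat_adjoint (mat_adjoint A) = (A :: complex mat)"
proof (rule eq_matI)
  note A' = carrier_mat_adjoint[OF assms]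
  fix i j assume "i < dim_row A" "j < dim_col A"
  then show "index_mat (mat_adjoint (mat_adjoint A)) (i, j) = index_mat A (i, j)"
    using assms by (simp add: index_mat_adjoint[OF A'] index_mat_adjoint[OF assms])
qed (use carrier_matD[OF carrier_mat_adjoint[OF carrier_mat_adjoint[OF assms]]] carrier_matD[OF assms] in simp_all)

lemma is_unitary_adjoint: "is_unitary n U \<Longrightarrow> is_unitary n (mat_adjoint U)"
  by (auto simp: is_unitary_def mat_adjoint_adjoint)

lemma unitary_hinner:
  assumes U: "is_unitary n U" and x: "x \<in> carrier_vec n" and y: "y \<in> carrier_vec n"
  shows "hinner (U *\<^sub>v x) (U *\<^sub>v y) = hinner x y"
proof -
  have c: "U \<in> carrier_mat n n" and UU: "mat_adjoint U * U = 1\<^sub>m n" using U by (auto simp: is_unitary_def)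
  have "hinner (U *\<^sub>v x) (U *\<^sub>v y) = hinner ((mat_adjoint U * U) *\<^sub>v x) y"
    using hinner_mult_mat_vec[OF c _ y] c x by (simp add: assoc_mult_mat_vec[OF carrier_mat_adjoint[OF c] c x])
  then show ?thesis using x by (simp add: UU)
qed

lemma pow_mat_commute:
  assumes A: "A \<in> carrier_mat n n"
  shows "A ^\<^sub>m k * A = A * A ^\<^sub>m k"
proof (induction k)
  case (Suc k)
  then show ?case using assoc_mult_mat[OF A pow_carrier_mat[OF A] A] by simp
qed (use A in simp)

lemma minv_eqI:
  assumes A: "A \<in> carrier_mat n n" and B: "B \<in> carrier_mat n n" and AB: "A * B = 1\<^sub>m n" "B * A = 1\<^sub>m n"
  shows "minv A = B"
proof -
  have "mat_inverse A \<noteq> None"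
  proof
    assume "mat_inverse A = None"
    then have "A \<notin> Units (ring_mat TYPE(complex) n ())" by (rule mat_inverse(1)[OF A])
    moreover have "A \<in> Units (ring_mat TYPE(complex) n ())"
      using A B AB by (auto simp: Units_def ring_mat_def)
    ultimately show False by simp
  qed
  then obtain C where C: "mat_inverse A = Some C" by blast
  from mat_inverse(2)[OF A C] have "A * C = 1\<^sub>m n" "C \<in> carrier_mat n n" by auto
  then have "C = B"
    using assoc_mult_mat[OF B A, of C n] AB B by simp
  then show ?thesis using C by (simp add: minv_def)
qed

lemma minv_unitary: "is_unitary n U \<Longrightarrow> minv U = mat_adjoint U"
  by (rule minv_eqI[of _ n]) (auto simp: is_unitary_def)

section \<open>Spectral measure of a cyclic vector\<close>

locale cyclic_unitary =
  fixes n :: nat and u :: "complex mat" and e :: "complex vec"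
  assumes unitary: "is_unitary n u" and e_carrier: "e \<in> carrier_vec n"
    and norm_e: "hnorm e = 1" and cyclic: "cyclic_vector n u e"
begin

lemma u_carrier [simp]: "u \<in> carrier_mat n n"
  using unitary by (simp add: is_unitary_def)

lemma dims [simp]: "dim_vec e = n" "dim_row u = n" "dim_col u = n"
  using e_carrier carrier_matD[OF u_carrier] by auto

lemma hinner_e: "hinner e e = 1"
  using norm_e hinner_self_of_real[OF e_carrier] by (simp add: hnorm_def)

lemma n_pos: "n > 0"
  using hinner_e hinner_eq_sum[OF e_carrier e_carrier] by (cases n) auto

text \<open>The vector \<open>p(u) e\<close>, by Horner's rule.\<close>

definition pv :: "complex poly \<Rightarrow> complex vec" where
  "pv p = fold_coeffs (\<lambda>a x. a \<cdot>\<^sub>v e + u *\<^sub>v x) p (0\<^sub>v n)"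

lemma pv_0 [simp]: "pv 0 = 0\<^sub>v n"
  by (simp add: pv_def)

lemma u_mult_0 [simp]: "u *\<^sub>v 0\<^sub>v n = 0\<^sub>v n"
  by (rule eq_vecI) (simp_all add: mult_mat_vec_index[OF u_carrier] del: index_mult_mat_vec)

lemma pv_pCons: "pv (pCons a p) = a \<cdot>\<^sub>v e + u *\<^sub>v pv p"
proof (cases "a = 0 \<and> p = 0")
  case True
  then show ?thesis by (intro eq_vecI) simp_all
next
  case False
  then show ?thesis by (cases "p = 0") (auto simp: pv_def)
qed

lemma pv_carrier [simp]: "pv p \<in> carrier_vec n"
  by (induction p) (use e_carrier in \<open>auto simp: pv_pCons intro!: add_carrier_vec mult_mat_vec_carrier[OF u_carrier]\<close>)

lemma dim_pv [simp]: "dim_vec (pv p) = n"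
  by (rule carrier_vecD[OF pv_carrier])

lemma u_pv_carrier [simp]: "u *\<^sub>v pv p \<in> carrier_vec n"
  by (rule mult_mat_vec_carrier[OF u_carrier pv_carrier])

lemma pv_z: "pv ([:0, 1:] * p) = u *\<^sub>v pv p"
  by (rule eq_vecI) (simp_all add: pv_pCons)

lemma pv_1: "pv 1 = e"
  unfolding one_pCons by (rule eq_vecI) (simp_all add: pv_pCons)

lemma pv_add: "pv (p + q) = pv p + pv q"
proof (induction p q rule: poly_induct2)
  case (pCons a p b q)
  have "pv (pCons a p + pCons b q) = (a + b) \<cdot>\<^sub>v e + (u *\<^sub>v pv p + u *\<^sub>v pv q)"
    by (simp add: pv_pCons pCons mult_add_distrib_mat_vec[OF u_carrier pv_carrier pv_carrier])
  also have "\<dots> = pv (pCons a p) + pv (pCons b q)"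
    by (rule eq_vecI) (simp_all add: pv_pCons algebra_simps del: index_mult_mat_vec)
  finally show ?case .
qed simp

lemma pv_smult: "pv (smult c p) = c \<cdot>\<^sub>v pv p"
proof (induction p)
  case (pCons a p)
  have "pv (smult c (pCons a p)) = (c * a) \<cdot>\<^sub>v e + c \<cdot>\<^sub>v (u *\<^sub>v pv p)"
    by (simp add: pv_pCons pCons.IH mult_mat_vec[OF u_carrier pv_carrier])
  also have "\<dots> = c \<cdot>\<^sub>v pv (pCons a p)"
    by (rule eq_vecI) (simp_all add: pv_pCons algebra_simps del: index_mult_mat_vec)
  finally show ?case .
qed (auto intro: eq_vecI)

lemma pv_diff: "pv (p - q) = pv p - pv q"
  using pv_add[of p "smult (-1) q"] pv_smult[of "-1" q]
  by (intro eq_vecI) simp_all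

lemma pv_sum_index:
  assumes "i < n"
  shows "vec_index (pv (\<Sum>k\<in>I. f k)) i = (\<Sum>k\<in>I. vec_index (pv (f k)) i)"
  using assms
  by (induction I rule: infinite_finite_induct) (simp_all add: pv_add)

lemma pow_mult_e: "(u ^\<^sub>m k) *\<^sub>v e = pv (monom 1 k)"
proof (induction k)
  case 0
  then show ?case using e_carrier u_carrier by (simp add: pv_1[unfolded one_pCons] monom_0)
next
  case (Suc k)
  have "(u ^\<^sub>m Suc k) *\<^sub>v e = u *\<^sub>v ((u ^\<^sub>m k) *\<^sub>v e)"
    using pow_mat_commute[OF u_carrier, of k] assoc_mult_mat_vec[OF u_carrier pow_carrier_mat[OF u_carrier] e_carrier] by simp
  then show ?case using pv_z[of "monom 1 k"] by (simp add: Suc monom_Suc)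
qed

section \<open>The bijection between polynomials of degree below n and vectors\<close>

lemma krylov_nth: "k < n \<Longrightarrow> krylov n u e ! k = pv (monom 1 k)"
  by (simp add: krylov_def pow_mult_e)

text \<open>In degree below \<open>n\<close>, \<open>K\<close> sends the coefficient vector of
  \<open>p\<close> to \<open>pv p\<close>; cyclicity then means that \<open>K\<close> is
  invertible.\<close>

definition K :: "complex mat" where "K = mat_of_cols n (krylov n u e)"

lemma K_carrier: "K \<in> carrier_mat n n"
  by (simp add: K_def krylov_def mat_of_cols_def)

lemma pv_eq_K:
  assumes "degree p < n"
  shows "pv p = K *\<^sub>v vec n (coeff p)"
proof (rule eq_vecI)
  fix i assume "i < dim_vec (K *\<^sub>v vec n (coeff p))"
  then have i: "i < n" using K_carrier by auto
  have "p = (\<Sum>k<n. smult (coeff p k) (monom 1 k))"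
  proof -
    have "p = (\<Sum>k\<le>degree p. monom (coeff p k) k)" by (rule poly_as_sum_of_monoms[symmetric])
    also have "\<dots> = (\<Sum>k<n. monom (coeff p k) k)"
      using assms by (intro sum.mono_neutral_left) (auto simp: coeff_eq_0)
    finally show ?thesis by (simp add: smult_monom)
  qed
  then have "vec_index (pv p) i = (\<Sum>k<n. vec_index (pv (smult (coeff p k) (monom 1 k))) i)"
    using pv_sum_index[OF i, of "\<lambda>k. smult (coeff p k) (monom 1 k)" "{..<n}"] by simp
  also have "\<dots> = (\<Sum>k<n. index_mat K (i, k) * coeff p k)"
    using i
    by (intro sum.cong refl) (simp add: pv_smult K_def mat_of_cols_index krylov_nth krylov_def pow_mult_e)
  also have "\<dots> = vec_index (K *\<^sub>v vec n (coeff p)) i"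
    using i by (simp add: mult_mat_vec_index[OF K_carrier] del: index_mult_mat_vec)
  finally show "vec_index (pv p) i = vec_index (K *\<^sub>v vec n (coeff p)) i" .
qed (use K_carrier in auto)

lemma det_K: "det K \<noteq> 0"
proof -
  interpret vs: vec_space "TYPE(complex)" n .
  have "set (krylov n u e) \<subseteq> carrier_vec n"
    by (auto simp: krylov_def pow_mult_e)
  then have cols: "cols K = krylov n u e" by (simp add: K_def cols_mat_of_cols)
  have "vs.span (set (krylov n u e)) = carrier_vec n"
    using cyclic by (simp add: cyclic_vector_def)
  then have "vs.rank K = n"
    using vs.dim_is_n unfolding vs.rank_def cols by (simp add: module_vec_def)
  then show ?thesis using vs.det_rank_iff[OF K_carrier] by simp
qed

lemma pv_eq_0_imp:
  assumes "pv p = 0\<^sub>v n" "degree p < n"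
  shows "p = 0"
proof -
  have "K *\<^sub>v vec n (coeff p) = 0\<^sub>v n" using assms pv_eq_K by simp
  then have "vec n (coeff p) = 0\<^sub>v n"
    using det_K det_0_iff_vec_prod_zero[OF K_carrier] by (metis vec_carrier)
  then have "coeff p k = 0" if "k < n" for k using that by (metis index_vec index_zero_vec(1))
  then show ?thesis using assms(2) by (metis leading_coeff_0_iff)
qed

lemma pv_surj:
  assumes "x \<in> carrier_vec n"
  obtains p where "degree p < n" "pv p = x"
proof -
  from det_non_zero_imp_unit[OF K_carrier det_K] obtain L where L: "L \<in> carrier_mat n n" "K * L = 1\<^sub>m n"
    by (auto simp: Units_def ring_mat_def)
  define c where "c = L *\<^sub>v x"
  have c: "c \<in> carrier_vec n" using L assms by (simp add: c_def)
  define p where "p = (\<Sum>k<n. monom (vec_index c k) k)"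
  have "degree p < n" unfolding p_def
    using n_pos by (intro degree_sum_less) (auto intro: le_less_trans[OF degree_monom_le])
  moreover have "coeff p k = vec_index c k" if "k < n" for k
    using that by (simp add: p_def coeff_sum coeff_monom sum.delta)
  then have "vec n (coeff p) = c" using c by (intro eq_vecI) auto
  moreover have "K *\<^sub>v c = x"
    using assms by (simp add: c_def assoc_mult_mat_vec[OF K_carrier L(1) assms, symmetric] L(2))
  ultimately show ?thesis using that[of p] pv_eq_K[of p] by simp
qed

text \<open>The inner product pulled back to polynomials of every degree. It is definite only below
  degree \<open>n\<close>, and turns out to be the \<open>L\<^sup>2\<close> product of the spectral
  measure.\<close>

definition h :: "complex poly \<Rightarrow> complex poly \<Rightarrow> complex" where
  "h p q = hinner (pv p) (pv q)"

lemma h_add_right: "h p (q + r) = h p q + h p r"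
  and h_diff_right: "h p (q - r) = h p q - h p r"
  and h_smult_right: "h p (smult c q) = c * h p q"
  and h_smult_left: "h (smult c p) q = cnj c * h p q"
  and h_add_left: "h (p + q) r = h p r + h q r"
  and h_cnj: "cnj (h p q) = h q p"
  and h_0_right [simp]: "h p 0 = 0"
  and h_0_left [simp]: "h 0 p = 0"
  using hinner_add_right[OF pv_carrier pv_carrier pv_carrier]
    hinner_add_left[OF pv_carrier pv_carrier pv_carrier]
    hinner_diff_right[OF pv_carrier pv_carrier pv_carrier] hinner_smult_right[OF pv_carrier pv_carrier]
    hinner_smult_left[OF pv_carrier pv_carrier] cnj_hinner[OF pv_carrier pv_carrier]
  by (simp_all add: h_def pv_add pv_diff pv_smult hinner_eq_sum[of _ n])

lemma h_sum_right: "h p (\<Sum>i\<in>I. q i) = (\<Sum>i\<in>I. h p (q i))"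
  by (induction I rule: infinite_finite_induct) (auto simp: h_add_right)

lemma h_sum_left: "h (\<Sum>i\<in>I. q i) p = (\<Sum>i\<in>I. h (q i) p)"
  by (induction I rule: infinite_finite_induct) (auto simp: h_add_left)

lemma h_mult_z: "h ([:0, 1:] * p) ([:0, 1:] * q) = h p q"
  unfolding h_def pv_z by (rule unitary_hinner[OF unitary pv_carrier pv_carrier])

lemma h_1: "h 1 1 = 1"
  by (simp add: h_def pv_1 hinner_e)

lemma h_self_eq_0: "h p p = 0 \<longleftrightarrow> pv p = 0\<^sub>v n"
  by (simp add: h_def hinner_self_eq_0_iff[OF pv_carrier])

lemma h_definite: "h p p = 0 \<Longrightarrow> degree p < n \<Longrightarrow> p = 0"
  using h_self_eq_0 pv_eq_0_imp by blast

lemma h_self_of_real: "h p p = of_real (Re (h p p))" and h_self_nonneg: "Re (h p p) \<ge> 0"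
  unfolding h_def using hinner_self_of_real[OF pv_carrier] hinner_self_nonneg[OF pv_carrier] by auto

section \<open>Spectral points and existence of the spectral measure\<close>

lemma minimal_polynomial_exists:
  obtains P where "degree P = n" "lead_coeff P = 1" "pv P = 0\<^sub>v n"
proof -
  obtain q where q: "degree q < n" "pv q = pv (monom 1 n)"
    using pv_surj[OF pv_carrier] by blast
  have "degree (monom 1 n - q) = n"
    using q by (intro degree_monom_diff)
  moreover have "coeff (monom 1 n - q) n = 1" using q coeff_eq_0[of q n] by simp
  moreover have "pv (monom 1 n - q) = 0\<^sub>v n" by (rule eq_vecI) (simp_all add: pv_diff q)
  ultimately show ?thesis using that by metis
qed

text \<open>The hypothesis says that \<open>u - w\<close> kills \<open>pv q\<close>. Pairing with an
  arbitrary \<open>r\<close> puts this into the form that combines with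
  \<open>h_mult_z\<close>.\<close>

lemma eigen_pv:
  assumes "pv ([:- w, 1:] * q) = 0\<^sub>v n"
  shows "h r ([:0, 1:] * q) = w * h r q" "h ([:0, 1:] * q) r = cnj w * h q r"
proof -
  have split: "[:0, 1:] * q = [:- w, 1:] * q + smult w q" by simp
  have zero: "h r ([:- w, 1:] * q) = 0" for r
    using assms hinner_eq_sum[OF pv_carrier, of "0\<^sub>v n"] by (simp add: h_def del: mult_pCons_left)
  show eq: "h r ([:0, 1:] * q) = w * h r q" for r
    unfolding split h_add_right h_smult_right zero by simp
  show "h ([:0, 1:] * q) r = cnj w * h q r"
    using eq[of r] h_cnj[of r "[:0, 1:] * q"] h_cnj[of r q] by (metis complex_cnj_mult)
qed

text \<open>A repeated root \<open>w\<close> of the minimal polynomial would give a vector \<open>x = (u - w) y \<noteq> 0\<close> with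
  \<open>u x = w x\<close>, but such a vector is orthogonal to itself because \<open>u\<close> is unitary.\<close>

lemma spectral_points_exist:
  obtains S l where "finite S" "card S = n" "\<And>w. w \<in> S \<Longrightarrow> cmod w = 1"
    "\<And>w v. w \<in> S \<Longrightarrow> v \<in> S \<Longrightarrow> poly (l w) v = (if v = w then 1 else 0)"
    "\<And>w. w \<in> S \<Longrightarrow> degree (l w) < n"
    "\<And>w. w \<in> S \<Longrightarrow> pv ([:- w, 1:] * l w) = 0\<^sub>v n"
    "\<And>p q. (\<And>w. w \<in> S \<Longrightarrow> poly p w = poly q w) \<Longrightarrow> pv p = pv q"
proof -
  obtain P where P: "degree P = n" "lead_coeff P = 1" "pv P = 0\<^sub>v n"
    by (rule minimal_polynomial_exists)
  have "P \<noteq> 0" using P by auto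
  \<comment> \<open>The cofactor has degree below \<open>n\<close>, so \<open>pv q\<close> is a
    nonzero eigenvector, and an isometry has eigenvalues on the circle only.\<close>
  have norm: "cmod w = 1" if "P = [:- w, 1:] * q" for w q
  proof -
    have q0: "q \<noteq> 0" using \<open>P \<noteq> 0\<close> that by auto
    have "degree P = degree q + 1" using that q0 degree_mult_eq[of "[:- w, 1:]" q] by simp
    then have "degree q < n" using P by simp
    then have hq: "h q q \<noteq> 0" using q0 h_definite by auto
    have pv: "pv ([:- w, 1:] * q) = 0\<^sub>v n" using P that by simp
    have "h q q = cnj w * (w * h q q)"
      using h_mult_z[of q q] eigen_pv[OF pv] by metis
    then have "w * cnj w = 1" using hq by (simp add: field_simps)
    then have "(cmod w)\<^sup>2 = 1" using complex_norm_square[of w] by (metis of_real_eq_1_iff of_real_power)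
    then show ?thesis 
      using norm_ge_zero[of w] by (simp add: power2_eq_1_iff)
  qed
  have "rsquarefree P"
    unfolding rsquarefree_def
  proof (intro conjI allI)
    fix w
    show "order w P = 0 \<or> order w P = 1"
    proof (rule ccontr)
      assume "\<not> (order w P = 0 \<or> order w P = 1)"
      then have "2 \<le> order w P" by auto
      then have "[:- w, 1:] ^ 2 dvd P" using order_1[of w P] power_le_dvd by blast
      then obtain r where "P = [:- w, 1:] ^ 2 * r" by (rule dvdE)
      then have r: "P = [:- w, 1:] * ([:- w, 1:] * r)"
        by (simp only: power2_eq_square mult.assoc)
      let ?q = "[:- w, 1:] * r"
      have q0: "?q \<noteq> 0" using \<open>P \<noteq> 0\<close> r by auto
      have "degree P = degree ?q + 1" using r q0 degree_mult_eq[of "[:- w, 1:]" ?q] by simp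
      then have "degree ?q < n" using P by simp
      have pv: "pv ([:- w, 1:] * ?q) = 0\<^sub>v n" using P r by simp
      have w: "w * cnj w = 1" using norm[OF r] complex_norm_square[of w] by simp
      \<comment> \<open>With x the vector of \<open>?q\<close> and y that of \<open>r\<close>:
        \<langle>x, y\<rangle> = \<langle>u x, u y\<rangle> = cnj w \<langle>x, u y\<rangle>. Since
        \<open>w\<close> has modulus one, \<langle>x, (u - w) y\<rangle> = 0, that is, \<langle>x,
        x\<rangle> = 0.\<close>
      have "h ?q r = cnj w * h ?q ([:0, 1:] * r)"
        using h_mult_z[of ?q r] eigen_pv[OF pv] by metis
      then have "w * h ?q r = h ?q ([:0, 1:] * r)" using w by (simp add: mult.assoc[symmetric])
      moreover have "?q = [:0, 1:] * r - smult w r" by simp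
      then have "h ?q ?q = h ?q ([:0, 1:] * r) - w * h ?q r"
        by (metis h_diff_right h_smult_right)
      ultimately have "h ?q ?q = 0" by simp
      then show False using h_definite \<open>degree ?q < n\<close> q0 by blast
    qed
  qed (fact \<open>P \<noteq> 0\<close>)
  define S where "S = {w. poly P w = 0}"
  have fin: "finite S" unfolding S_def using \<open>P \<noteq> 0\<close> by (rule poly_roots_finite)
  have cardS: "card S = n"
    using \<open>rsquarefree P\<close> rsquarefree_card_degree[OF \<open>P \<noteq> 0\<close>] P by (simp add: S_def)
  have prodP: "P = (\<Prod>w\<in>S. [:- w, 1:])"
    using complex_poly_decompose_rsquarefree[OF \<open>rsquarefree P\<close>] P by (simp add: S_def)
  \<comment> \<open>The cofactors of \<open>P\<close>, normalised to the Lagrange polynomials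
    \<open>l w\<close>. These sum to \<open>1\<close> on \<open>S\<close>, so
    \<open>pv (l w)\<close> is the component of \<open>e\<close> in the eigenspace of
    \<open>w\<close>.\<close>
  define L where "L w = (\<Prod>v\<in>S - {w}. [:- v, 1:])" for w
  define l where "l w = smult (1 / poly (L w) w) (L w)" for w
  have PL: "P = [:- w, 1:] * L w" if "w \<in> S" for w
    unfolding prodP L_def using fin that by (rule prod.remove)
  have L0: "poly (L w) w \<noteq> 0" for w using fin by (simp add: L_def poly_prod)
  have Lv: "poly (L w) v = 0" if "v \<in> S" "v \<noteq> w" for w v
    using fin that by (simp add: L_def poly_prod)
  show ?thesis
  proof
    show "finite S" "card S = n" by fact+
    fix w assume w: "w \<in> S"
    show "cmod w = 1" using norm[OF PL[OF w]] .
    have "degree (L w) = card (S - {w})" by (simp add: L_def degree_prod_eq_sum_degree)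
    then show "degree (l w) < n" using w fin cardS n_pos by (simp add: l_def L0)
    have "[:- w, 1:] * l w = smult (1 / poly (L w) w) P"
      unfolding l_def PL[OF w] by (rule mult_smult_right)
    then show "pv ([:- w, 1:] * l w) = 0\<^sub>v n"
      by (simp only: pv_smult P) (auto intro: eq_vecI)
    fix v assume "v \<in> S"
    then show "poly (l w) v = (if v = w then 1 else 0)" using L0 Lv by (simp add: l_def)
  next
    fix p q :: "complex poly" assume eq: "\<And>w. w \<in> S \<Longrightarrow> poly p w = poly q w"
    have mult: "pv (r * P) = 0\<^sub>v n" for r
    proof (induction r)
      case (pCons a r)
      have "pCons a r * P = smult a P + [:0, 1:] * (r * P)" by simp
      then show ?case
        by (simp only: pv_add pv_z pv_smult P pCons.IH u_mult_0) (auto intro: eq_vecI)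
    qed simp
    have "P dvd p - q"
    proof (rule ccontr)
      assume ndvd: "\<not> P dvd p - q"
      define r where "r = (p - q) mod P"
      have "r \<noteq> 0" using ndvd by (simp add: r_def mod_eq_0_iff_dvd)
      then have "degree r < n"
        using degree_mod_less'[OF \<open>P \<noteq> 0\<close>, of "p - q"] P by (simp add: r_def)
      moreover have "poly r w = 0" if "w \<in> S" for w
        using that eq[OF that] by (simp add: r_def poly_mod S_def)
      then have "card S \<le> card {w. poly r w = 0}"
        by (intro card_mono poly_roots_finite \<open>r \<noteq> 0\<close>) auto
      ultimately show False using card_poly_roots_bound[OF \<open>r \<noteq> 0\<close>] cardS by simp
    qed
    then obtain r where "p - q = r * P" by (metis dvdE mult.commute)
    then have "p = q + r * P" by (simp add: algebra_simps)
    then show "pv p = pv q" by (simp add: pv_add mult) 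
  qed
qed

text \<open>The mass at \<open>w\<close> is the squared length of the eigencomponent
  \<open>pv (l w)\<close> of \<open>e\<close>. Components for different points are orthogonal since
  \<open>u\<close> is unitary, so interpolation on \<open>S\<close> diagonalises \<open>h\<close>;
  total mass one is \<open>h_1\<close>.\<close>

lemma spectral_measure_exists:
  obtains M where "circle_measure M" "card (mass_points M) = n"
    "\<And>p q. L2_inner M (poly p) (poly q) = h p q"
proof -
  obtain S l where S: "finite S" "card S = n" and norm: "\<And>w. w \<in> S \<Longrightarrow> cmod w = 1"
    and l: "\<And>w v. w \<in> S \<Longrightarrow> v \<in> S \<Longrightarrow> poly (l w) v = (if v = w then 1 else 0)"
    and dl: "\<And>w. w \<in> S \<Longrightarrow> degree (l w) < n"
    and eig: "\<And>w. w \<in> S \<Longrightarrow> pv ([:- w, 1:] * l w) = 0\<^sub>v n"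
    and cong: "\<And>p q. (\<And>w. w \<in> S \<Longrightarrow> poly p w = poly q w) \<Longrightarrow> pv p = pv q"
    by (rule spectral_points_exist) blast
  define m where "m w = Re (h (l w) (l w))" for w
  have m_pos: "m w > 0" if w: "w \<in> S" for w
  proof -
    have "l w \<noteq> 0" using l[OF w w] by auto
    then have "h (l w) (l w) \<noteq> 0" using h_definite dl[OF w] by blast
    then have "m w \<noteq> 0" using h_self_of_real[of "l w"] by (auto simp: m_def)
    then show ?thesis using h_self_nonneg[of "l w"] by (simp add: m_def)
  qed
  have orth: "h (l w) (l v) = 0" if "w \<in> S" "v \<in> S" "w \<noteq> v" for w v
  proof (rule ccontr)
    assume ne: "h (l w) (l v) \<noteq> 0"
    have "h (l w) (l v) = cnj w * (v * h (l w) (l v))"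
      using h_mult_z[of "l w" "l v"] eigen_pv(1)[OF eig[OF that(2)]] eigen_pv(2)[OF eig[OF that(1)]] by metis
    then have "cnj w * v = 1" using ne by simp
    moreover have "w * cnj w = 1" using norm[OF that(1)] complex_norm_square[of w] by simp
    ultimately have "v = w" by (metis mult.assoc mult.commute mult.left_neutral)
    then show False using that by simp
  qed
  have h_eq: "h p q = (\<Sum>w\<in>S. of_real (m w) * (cnj (poly p w) * poly q w))" for p q
  proof -
    have pv: "pv p = pv (\<Sum>w\<in>S. smult (poly p w) (l w))" for p
    proof (rule cong)
      fix v assume v: "v \<in> S"
      have "poly (\<Sum>w\<in>S. smult (poly p w) (l w)) v = (\<Sum>w\<in>S. if v = w then poly p w else 0)"
        unfolding poly_sum using l v by (intro sum.cong refl) auto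
      then show "poly p v = poly (\<Sum>w\<in>S. smult (poly p w) (l w)) v" using S v by simp
    qed
    have "h p q = h (\<Sum>w\<in>S. smult (poly p w) (l w)) (\<Sum>v\<in>S. smult (poly q v) (l v))"
      unfolding h_def using pv[of p] pv[of q] by simp
    also have "\<dots> = (\<Sum>w\<in>S. \<Sum>v\<in>S. cnj (poly p w) * (poly q v * h (l w) (l v)))"
      by (simp add: h_sum_left h_sum_right h_smult_left h_smult_right sum_distrib_left)
        (subst sum.swap, simp add: mult.left_commute)
    also have "\<dots> = (\<Sum>w\<in>S. \<Sum>v\<in>S. if v = w then of_real (m w) * (cnj (poly p w) * poly q w) else 0)"
      using orth h_self_of_real by (intro sum.cong refl) (auto simp: m_def)
    also have "\<dots> = (\<Sum>w\<in>S. of_real (m w) * (cnj (poly p w) * poly q w))"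
      using S by (simp add: sum.delta)
    finally show ?thesis .
  qed
  have sum_m: "(\<Sum>w\<in>S. m w) = 1"
  proof -
    have "complex_of_real (\<Sum>w\<in>S. m w) = 1" using h_eq[of 1 1] h_1 by simp
    then show ?thesis using of_real_eq_1_iff by blast
  qed
  \<comment> \<open>A point measure has \<open>S\<close> itself as its space; the push-forward along
    the inclusion makes it a Borel measure on the plane.\<close>
  define M where "M = distr (point_measure S (\<lambda>w. ennreal (m w))) borel (\<lambda>z :: complex. z)"
  have sets: "sets M = sets borel" by (simp add: M_def)
  have em: "emeasure M A = ennreal (\<Sum>w\<in>S \<inter> A. m w)" if "A \<in> sets borel" for A
  proof -
    have "emeasure M A = emeasure (point_measure S (\<lambda>w. ennreal (m w))) ((\<lambda>z. z) -` A \<inter> S)"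
      unfolding M_def using that by (subst emeasure_distr) (auto simp: space_point_measure)
    also have "\<dots> = (\<Sum>w\<in>S \<inter> A. ennreal (m w))"
      using S by (subst emeasure_point_measure_finite) (auto simp: Int_commute)
    also have "\<dots> = ennreal (\<Sum>w\<in>S \<inter> A. m w)"
      using m_pos by (intro sum_ennreal) (auto intro: less_imp_le)
    finally show ?thesis .
  qed
  have "prob_space M"
    using em[of UNIV] sum_m by (intro prob_spaceI) (simp add: M_def)
  have mass: "measure M {z} = (if z \<in> S then m z else 0)" for z
    using em[of "{z}"] m_pos[of z] by (simp add: measure_def)
  have mp: "mass_points M = S"
    using m_pos by (auto simp: mass_points_def mass)
  have AE: "AE z in M. z \<in> S"
  proof (rule AE_I[of _ _ "UNIV - S"])
    have "closed S" using S by (simp add: finite_imp_closed)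
    then have B: "UNIV - S \<in> sets borel" by auto
    then show "emeasure M (UNIV - S) = 0" "UNIV - S \<in> sets M" using em[OF B] sets by auto
  qed auto
  have "AE z in M. z \<in> sphere 0 1"
    using AE by eventually_elim (simp add: norm)
  then have cm: "circle_measure M"
    using \<open>prob_space M\<close> sets AE S by (simp add: circle_measure_def circle_prob_def mp)
  interpret M: circle_measure M by fact
  show ?thesis
  proof
    show "L2_inner M (poly p) (poly q) = h p q" for p q
      using M.ip_eq[of p q] by (simp add: M.ip_def mp mass h_eq)
  qed (use cm S mp in auto)
qed

text \<open>For negative \<open>k\<close> the inverse of \<open>u\<close> is its adjoint. It moves
  to the left argument as a positive power, and conjugation there matches inversion of
  \<open>z\<close> on the circle.\<close>

lemma hinner_mpowi: 
  assumes M: "circle_measure M" and L2: "\<And>p q. L2_inner M (poly p) (poly q) = h p q"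
  shows "hinner e (mpowi u k *\<^sub>v e) = (\<integral>z. z powi k \<partial>M)"
proof (cases "k \<ge> 0")
  case True
  then have "hinner e (mpowi u k *\<^sub>v e) = h 1 (monom 1 (nat k))"
    by (simp add: mpowi_def pow_mult_e h_def pv_1)
  then show ?thesis using True L2[of 1 "monom 1 (nat k)", symmetric]
    by (simp add: L2_inner_def poly_monom power_int_def)
next
  case False
  interpret M: circle_measure M by fact
  define j where "j = nat (- k)"
  have a: "mat_adjoint u \<in> carrier_mat n n" by simp
  have step: "hinner x ((mat_adjoint u ^\<^sub>m j) *\<^sub>v y) = hinner ((u ^\<^sub>m j) *\<^sub>v x) y"
    if "x \<in> carrier_vec n" "y \<in> carrier_vec n" for x y j
    using that
  proof (induction j arbitrary: x y)
    case (Suc j)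
    note p = pow_carrier_mat[OF a, of j] pow_carrier_mat[OF u_carrier, of j]
    have "hinner x ((mat_adjoint u ^\<^sub>m Suc j) *\<^sub>v y) = hinner ((u ^\<^sub>m j) *\<^sub>v x) (mat_adjoint u *\<^sub>v y)"
      using Suc assoc_mult_mat_vec[OF p(1) a Suc.prems(2)] mult_mat_vec_carrier[OF a Suc.prems(2)] by simp
    also have "\<dots> = hinner (u *\<^sub>v ((u ^\<^sub>m j) *\<^sub>v x)) y"
      using hinner_mult_mat_vec[OF a mult_mat_vec_carrier[OF p(2) Suc.prems(1)] Suc.prems(2)]
      by (simp add: mat_adjoint_adjoint[OF u_carrier])
    also have "u *\<^sub>v ((u ^\<^sub>m j) *\<^sub>v x) = (u ^\<^sub>m Suc j) *\<^sub>v x"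
      using pow_mat_commute[OF u_carrier, of j] assoc_mult_mat_vec[OF u_carrier p(2) Suc.prems(1)] by simp
    finally show ?case .
  qed (use carrier_matD[OF a] in simp)
  have "hinner e (mpowi u k *\<^sub>v e) = h (monom 1 j) 1"
    using False step[OF e_carrier e_carrier, of j]
    by (simp add: mpowi_def minv_unitary[OF unitary] j_def[symmetric] pow_mult_e h_def pv_1)
  also have "\<dots> = (\<Sum>z\<in>mass_points M. of_real (measure M {z}) * z powi k)"
    unfolding L2[symmetric] M.ip_def[symmetric] M.ip_eq
  proof (intro sum.cong refl)
    fix z assume "z \<in> mass_points M"
    then have "inverse z = cnj z" by (intro inverse_unique M.mass_cnj)
    then show "of_real (measure M {z}) * (cnj (poly (monom 1 j) z) * poly 1 z) = of_real (measure M {z}) * z powi k"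
      using False by (simp add: poly_monom power_int_def j_def)
  qed
  also have "\<dots> = (\<integral>z. z powi k \<partial>M)"
    by (rule M.integral_eq_sum[symmetric, OF M.measurable_powi])
  finally show ?thesis .
qed

lemma spectral_measure:
  "circle_measure (spectral_measure n u e)" "card (mass_points (spectral_measure n u e)) = n"
  "L2_inner (spectral_measure n u e) (poly p) (poly q) = h p q"
proof -
  obtain M where M: "circle_measure M" "card (mass_points M) = n"
    "\<And>p q. L2_inner M (poly p) (poly q) = h p q" by (rule spectral_measure_exists) blast
  interpret M: circle_measure M by (rule M(1))
  have "spectral_measure n u e = M"
    unfolding spectral_measure_def
  proof (rule the_equality)
    show "circle_prob M \<and> (\<forall>k. hinner e (mpowi u k *\<^sub>v e) = (\<integral>z. z powi k \<partial>M))"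
      using M.circle hinner_mpowi[OF M(1,3)] by blast
    fix \<nu> assume "circle_prob \<nu> \<and> (\<forall>k. hinner e (mpowi u k *\<^sub>v e) = (\<integral>z. z powi k \<partial>\<nu>))"
    then show "\<nu> = M"
      using hinner_mpowi[OF M(1,3)] by (intro M.moments_inject) auto
  qed
  with M show "circle_measure (spectral_measure n u e)" "card (mass_points (spectral_measure n u e)) = n"
    "L2_inner (spectral_measure n u e) (poly p) (poly q) = h p q" by auto
qed

sublocale sm: circle_measure "spectral_measure n u e"
  by (rule spectral_measure)

section \<open>The Gram-Schmidt basis as orthonormal polynomials\<close>

lemma ip_eq_h: "sm.ip p q = h p q"
  by (simp add: sm.ip_def spectral_measure)

abbreviation OP :: "nat \<Rightarrow> complex poly" where
  "OP k \<equiv> monic_OP (spectral_measure n u e) k"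

lemma adjuster_pv:
  "adjuster n (pv q) (map pv Ps) = pv (\<Sum>P\<leftarrow>Ps. smult (- (h P q / h P P)) P)"
  by (induction Ps) (simp_all add: pv_add pv_smult h_def hinner_def del: Polynomial.smult_minus_left)

text \<open>\<open>gram_schmidt_sub\<close> accumulates its results in reverse order; hence the
  \<open>rev\<close>, and an induction that descends from \<open>k = n\<close> to the wanted case
  \<open>k = 0\<close>.\<close>

lemma gram_schmidt_sub_krylov:
  "k \<le> n \<Longrightarrow> gram_schmidt_sub n (map pv (map OP (rev [0..<k]))) (map (\<lambda>j. pv (monom 1 j)) [k..<n])
    = map pv (map OP (rev [0..<n]))"
proof (induction rule: inc_induct)
  case (step k)
  have "(\<Sum>P\<leftarrow>map OP (rev [0..<k]). smult (- (h P (monom 1 k) / h P P)) P)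
      = - (\<Sum>i<k. smult (h (OP i) (monom 1 k) / h (OP i) (OP i)) (OP i))"
    by (simp add: comp_def rev_map[symmetric] sum_list_rev interv_sum_list_conv_sum_set_nat
        lessThan_atLeast0 sum_negf)
  then have "adjuster n (pv (monom 1 k)) (map pv (map OP (rev [0..<k]))) + pv (monom 1 k) = pv (OP k)"
    unfolding adjuster_pv pv_add[symmetric]
    using sm.monic_OP_gram_schmidt[of k] step.hyps by (simp add: spectral_measure ip_eq_h)
  then show ?case
    using step by (simp add: upt_conv_Cons)
qed simp

lemma gram_schmidt_krylov: "gram_schmidt n (krylov n u e) = map (\<lambda>k. pv (OP k)) [0..<n]"
  using gram_schmidt_sub_krylov[of 0]
  by (simp add: gram_schmidt_def krylov_def pow_mult_e rev_map comp_def)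

lemma hnorm_pv: "hnorm (pv (OP k)) = sm.OP_norm k"
  by (simp add: hnorm_def sm.OP_norm_def L2_norm_def spectral_measure h_def)

lemma gram_schmidt_onb_krylov:
  assumes "k < n"
  shows "gram_schmidt_onb n (krylov n u e) ! k = pv (sm.ON_poly k)"
  using assms by (simp add: gram_schmidt_onb_def gram_schmidt_krylov hnorm_pv sm.ON_poly_def pv_smult)

end

section \<open>Reflections\<close>

lemma index_adjoint_mult:
  assumes A: "A \<in> carrier_mat n n" and B: "B \<in> carrier_mat n n" and ij: "i < n" "j < n"
  shows "index_mat (mat_adjoint A * B) (i, j) = hinner (col A i) (col B j)"
proof -
  note A' = carrier_mat_adjoint[OF A]
  have "index_mat (mat_adjoint A * B) (i, j) = row (mat_adjoint A) i \<bullet> col B j"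
    using ij carrier_matD[OF A'] carrier_matD[OF B] by (simp only: index_mult_mat(1))
  also have "\<dots> = (\<Sum>k<n. vec_index (row (mat_adjoint A) i) k * vec_index (col B j) k)"
    using carrier_matD[OF B] by (simp add: scalar_prod_def lessThan_atLeast0)
  also have "\<dots> = (\<Sum>k<n. cnj (vec_index (col A i) k) * vec_index (col B j) k)"
  proof (intro sum.cong refl)
    fix k assume "k \<in> {..<n}"
    then show "vec_index (row (mat_adjoint A) i) k * vec_index (col B j) k
        = cnj (vec_index (col A i) k) * vec_index (col B j) k"
      using ij carrier_matD[OF A'] carrier_matD[OF A] index_mat_adjoint[OF A, of i k] by simp
  qed
  finally show ?thesis
    using hinner_eq_sum[of "col A i" n "col B j"] col_dim[of A i] col_dim[of B j]
    unfolding carrier_matD(1)[OF A] carrier_matD(1)[OF B] by simp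
qed

lemma is_unitaryI:
  assumes A: "A \<in> carrier_mat n n"
    and iso: "\<And>i j. i < n \<Longrightarrow> j < n \<Longrightarrow> hinner (col A i) (col A j) = (if i = j then 1 else 0)"
  shows "is_unitary n A"
proof -
  note A' = carrier_mat_adjoint[OF A]
  have "mat_adjoint A * A = 1\<^sub>m n"
  proof (rule eq_matI)
    fix i j assume "i < dim_row (1\<^sub>m n :: complex mat)" "j < dim_col (1\<^sub>m n :: complex mat)"
    then have ij: "i < n" "j < n" by auto
    show "index_mat (mat_adjoint A * A) (i, j) = index_mat (1\<^sub>m n) (i, j)"
      unfolding index_adjoint_mult[OF A A ij] iso[OF ij] using ij by simp
  qed (use carrier_matD[OF A] carrier_matD[OF A'] in auto)
  then show ?thesis using A mat_mult_left_right_inverse[OF A' A] by (simp add: is_unitary_def)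
qed

lemma reflection_onto_carrier [simp]: "reflection_onto n e m \<in> carrier_mat n n"
  by (auto simp: reflection_onto_def)

definition refl_coeff :: "complex vec \<Rightarrow> complex vec \<Rightarrow> complex" where
  "refl_coeff e m = 1 / (1 - hinner m e)"

text \<open>For \<open>e = m\<close> the vector \<open>m - e\<close> vanishes, so the formula also covers the identity.\<close>

lemma reflection_onto_mult_vec:
  assumes e: "e \<in> carrier_vec n" and m: "m \<in> carrier_vec n" and x: "x \<in> carrier_vec n"
  shows "reflection_onto n e m *\<^sub>v x = x - (refl_coeff e m * hinner (m - e) x) \<cdot>\<^sub>v (m - e)"
proof (rule eq_vecI)
  have d: "m - e \<in> carrier_vec n" using e m by simp
  fix i assume "i < dim_vec (x - (refl_coeff e m * hinner (m - e) x) \<cdot>\<^sub>v (m - e))"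
  then have i: "i < n" using e by simp
  show "vec_index (reflection_onto n e m *\<^sub>v x) i = vec_index (x - (refl_coeff e m * hinner (m - e) x) \<cdot>\<^sub>v (m - e)) i"
  proof (cases "e = m")
    case True
    then show ?thesis using i e m x by (simp add: reflection_onto_def)
  next
    case False
    have "vec_index (reflection_onto n e m *\<^sub>v x) i
      = (\<Sum>j<n. (if i = j then vec_index x j else 0) - refl_coeff e m * (vec_index (m - e) i * (cnj (vec_index (m - e) j) * vec_index x j)))"
      unfolding mult_mat_vec_index[OF reflection_onto_carrier x i]
      using False i e m by (intro sum.cong refl) (auto simp: reflection_onto_def refl_coeff_def algebra_simps)
    also have "\<dots> = vec_index x i - refl_coeff e m * (vec_index (m - e) i * hinner (m - e) x)"
      unfolding sum_subtractf hinner_eq_sum[OF d x] sum_distrib_left using i by simp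
    finally show ?thesis using i e m x by (simp add: algebra_simps)
  qed
qed (use e m x carrier_matD[OF reflection_onto_carrier, of n e m] in auto)

lemma
  assumes e: "e \<in> carrier_vec n" and m: "m \<in> carrier_vec n"
    and x: "x \<in> carrier_vec n" and y: "y \<in> carrier_vec n"
  shows hinner_reflection_onto_right: "hinner y (reflection_onto n e m *\<^sub>v x)
      = hinner y x - refl_coeff e m * hinner y (m - e) * hinner (m - e) x"
    and hinner_reflection_onto_left: "hinner (reflection_onto n e m *\<^sub>v y) x
      = hinner y x - cnj (refl_coeff e m) * hinner y (m - e) * hinner (m - e) x"
proof -
  have d: "m - e \<in> carrier_vec n" using e m by simp
  show "hinner y (reflection_onto n e m *\<^sub>v x)
      = hinner y x - refl_coeff e m * hinner y (m - e) * hinner (m - e) x"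
    unfolding reflection_onto_mult_vec[OF e m x]
    using hinner_diff_right[OF y x smult_carrier_vec[THEN iffD2, OF d]] hinner_smult_right[OF y d]
    by simp
  have "cnj (hinner (m - e) y) = hinner y (m - e)" by (rule cnj_hinner[OF d y])
  then show "hinner (reflection_onto n e m *\<^sub>v y) x
      = hinner y x - cnj (refl_coeff e m) * hinner y (m - e) * hinner (m - e) x"
    unfolding reflection_onto_mult_vec[OF e m y]
    using hinner_diff_left[OF x y smult_carrier_vec[THEN iffD2, OF d]] hinner_smult_left[OF d x]
    by simp
qed

text \<open>Put \<open>s = hinner m e\<close>, \<open>d = m - e\<close> and
  \<open>c = 1 / (1 - s)\<close>. Isometry reduces to
  \<open>c + cnj c = cnj c * c * hinner d d\<close>, which holds because for unit vectors the
  squared length of \<open>d\<close> is \<open>(1 - s) + cnj (1 - s)\<close>.\<close>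

lemma unit_reflection:
  assumes e: "e \<in> carrier_vec n" and m: "m \<in> carrier_vec n"
    and unit: "hinner e e = 1" "hinner m m = 1"
  shows reflection_onto_maps: "reflection_onto n e m *\<^sub>v e = m"
    and is_unitary_reflection_onto: "is_unitary n (reflection_onto n e m)"
    and is_reflection_reflection_onto: "is_reflection n (reflection_onto n e m)"
proof -
  let ?d = "m - e" and ?R = "reflection_onto n e m" and ?s = "hinner m e"
  have d: "?d \<in> carrier_vec n" using e m by simp
  have de: "hinner ?d e = ?s - 1"
    using hinner_diff_left[OF e m e] unit by simp
  have dd: "hinner ?d ?d = 2 - ?s - cnj ?s"
    using hinner_diff_left[OF d m e] hinner_diff_right[OF m m e] hinner_diff_right[OF e m e] unit
      cnj_hinner[OF m e] by simp
  have s: "?s \<noteq> 1" if "e \<noteq> m"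
  proof
    assume "?s = 1"
    then have "hinner ?d ?d = 0" by (simp add: dd)
    then have "?d = 0\<^sub>v n" using hinner_self_eq_0_iff[OF d] by simp
    then have "vec_index m i = vec_index e i" if "i < n" for i
      using that e m by (metis carrier_vecD index_minus_vec(1) index_zero_vec(1) right_minus_eq)
    then show False using \<open>e \<noteq> m\<close> e m by (metis carrier_vecD eq_vecI)
  qed
  show "?R *\<^sub>v e = m"
  proof (cases "e = m")
    case True
    then show ?thesis using m by (simp add: reflection_onto_def)
  next
    case False
    have "refl_coeff e m * hinner ?d e = - 1"
      unfolding refl_coeff_def de using s[OF False] by (simp add: field_simps)
    then show ?thesis
      unfolding reflection_onto_mult_vec[OF e m e] using e m by (intro eq_vecI) simp_all
  qed
  have key: "refl_coeff e m + cnj (refl_coeff e m) = cnj (refl_coeff e m) * refl_coeff e m * hinner ?d ?d"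
    if "e \<noteq> m"
  proof -
    have "1 - ?s \<noteq> 0" "1 - cnj ?s \<noteq> 0" using s[OF that] complex_cnj_cancel_iff[of ?s 1] by auto
    then show ?thesis unfolding dd refl_coeff_def by (simp add: field_simps)
  qed
  have iso: "hinner (?R *\<^sub>v x) (?R *\<^sub>v y) = hinner x y" if x: "x \<in> carrier_vec n" and y: "y \<in> carrier_vec n" for x y
  proof (cases "e = m")
    case True
    then show ?thesis using x y by (simp add: reflection_onto_def)
  next
    case False
    have Ry: "?R *\<^sub>v y \<in> carrier_vec n" by (rule mult_mat_vec_carrier[OF reflection_onto_carrier y])
    have "hinner (?R *\<^sub>v x) (?R *\<^sub>v y) = hinner x y + hinner x ?d * hinner ?d y *
        (cnj (refl_coeff e m) * refl_coeff e m * hinner ?d ?d - (refl_coeff e m + cnj (refl_coeff e m)))"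
      unfolding hinner_reflection_onto_left[OF e m Ry x] hinner_reflection_onto_right[OF e m y x]
        hinner_reflection_onto_right[OF e m y d] by (simp add: algebra_simps)
    then show ?thesis using key[OF False] by simp
  qed
  show U: "is_unitary n ?R"
  proof (rule is_unitaryI)
    fix i j assume ij: "i < n" "j < n"
    have "col ?R k = ?R *\<^sub>v unit_vec n k" if "k < n" for k
      using that carrier_matD[OF reflection_onto_carrier, of n e m]
      by (intro eq_vecI) (simp_all add: scalar_prod_right_unit)
    then show "hinner (col ?R i) (col ?R j) = (if i = j then 1 else 0)"
      using ij iso[of "unit_vec n i" "unit_vec n j"] hinner_eq_sum[of "unit_vec n i" n "unit_vec n j"]
      by (simp add: if_distrib[of cnj] if_distrib[of "\<lambda>x. x * _"] cong: if_cong)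
  qed simp
  have "vec_space.rank n (?R - 1\<^sub>m n) \<le> 1"
  proof (rule vec_space.rank_le_1_product_entries)
    show "?R - 1\<^sub>m n \<in> carrier_mat n n" by (intro minus_carrier_mat one_carrier_mat)
    fix i j assume "i < dim_row (?R - 1\<^sub>m n)" "j < dim_col (?R - 1\<^sub>m n)"
    then show "index_mat (?R - 1\<^sub>m n) (i, j) = (- refl_coeff e m * vec_index ?d i) * cnj (vec_index ?d j)"
      using e m by (auto simp: reflection_onto_def refl_coeff_def)
  qed
  with U show "is_reflection n ?R" by (simp add: is_reflection_def)
qed

section \<open>Ordered products of matrices\<close>

lemma mprod_carrier: "(\<And>A. A \<in> set As \<Longrightarrow> A \<in> carrier_mat n n) \<Longrightarrow> mprod n As \<in> carrier_mat n n"
proof (induction As)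
  case (Cons A As)
  then show ?case using mult_carrier_mat[of A n n "mprod n As" n] by (simp add: mprod_def)
qed (simp add: mprod_def)

lemma mprod_Nil: "mprod n [] = 1\<^sub>m n" and mprod_Cons: "mprod n (A # As) = A * mprod n As"
  by (simp_all add: mprod_def)

lemma mprod_snoc:
  assumes "\<And>A. A \<in> set As \<Longrightarrow> A \<in> carrier_mat n n" "B \<in> carrier_mat n n"
  shows "mprod n (As @ [B]) = mprod n As * B"
  using assms
proof (induction As)
  case (Cons A As)
  then show ?case
    using assoc_mult_mat[of A n n "mprod n As" n B n] mprod_carrier[of As n] by (simp add: mprod_Cons)
qed (simp add: mprod_def)

lemma mprod_conj:
  assumes F: "F \<in> carrier_mat n n" and G: "G \<in> carrier_mat n n" and GF: "G * F = 1\<^sub>m n" "F * G = 1\<^sub>m n"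
    and As: "\<And>A. A \<in> set As \<Longrightarrow> A \<in> carrier_mat n n"
  shows "F * mprod n As * G = mprod n (map (\<lambda>A. F * A * G) As)"
  using As
proof (induction As)
  case (Cons A As)
  let ?P = "mprod n As"
  have A: "A \<in> carrier_mat n n" and P: "?P \<in> carrier_mat n n" using Cons.prems mprod_carrier[of As n] by auto
  have "(F * A * G) * (F * ?P * G) = F * A * (G * (F * (?P * G)))"
    using F G A P by (simp add: assoc_mult_mat[of _ n n _ n _ n])
  also have "G * (F * (?P * G)) = ?P * G"
    using F G P GF by (simp add: assoc_mult_mat[of G n n F n "?P * G" n, symmetric])
  finally have "(F * A * G) * (F * ?P * G) = F * (A * ?P) * G"
    using F G A P by (simp add: assoc_mult_mat[of _ n n _ n _ n])
  then show ?case using Cons by (simp add: mprod_Cons)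
qed (use F G GF in \<open>simp add: mprod_def\<close>)

section \<open>Decomposition of a unitary along an arbitrary orthonormal basis\<close>

locale orthonormal_frame =
  fixes n :: nat and u :: "complex mat" and \<epsilon> :: "nat \<Rightarrow> complex vec"
  assumes unitary: "is_unitary n u"
    and eps_carrier [simp]: "\<And>k. k < n \<Longrightarrow> \<epsilon> k \<in> carrier_vec n"
    and orthonormal: "\<And>i j. i < n \<Longrightarrow> j < n \<Longrightarrow> hinner (\<epsilon> i) (\<epsilon> j) = (if i = j then 1 else 0)"
begin

lemma u_carrier: "u \<in> carrier_mat n n"
  using unitary by (simp add: is_unitary_def)

definition E :: "complex mat" where "E = mat_of_cols n (map \<epsilon> [0..<n])"

lemma E_carrier: "E \<in> carrier_mat n n"
  by (simp add: E_def mat_of_cols_def)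

lemma col_E: "j < n \<Longrightarrow> col E j = \<epsilon> j"
  by (simp add: E_def)

lemma unitary_E: "is_unitary n E"
  by (intro is_unitaryI E_carrier) (simp add: col_E orthonormal)

lemma index_conj_E:
  assumes A: "A \<in> carrier_mat n n" and ij: "i < n" "j < n"
  shows "index_mat (mat_adjoint E * A * E) (i, j) = hinner (\<epsilon> i) (A *\<^sub>v \<epsilon> j)"
proof -
  have "mat_adjoint E * A * E = mat_adjoint E * (A * E)"
    by (rule assoc_mult_mat[OF carrier_mat_adjoint[OF E_carrier] A E_carrier])
  moreover have "col (A * E) j = A *\<^sub>v \<epsilon> j"
    using col_mult2[OF A E_carrier ij(2)] by (simp add: col_E ij)
  ultimately show ?thesis
    using index_adjoint_mult[OF E_carrier mult_carrier_mat[OF A E_carrier] ij] by (simp add: col_E ij)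
qed

lemma parseval:
  assumes x: "x \<in> carrier_vec n" and y: "y \<in> carrier_vec n"
  shows "hinner x y = (\<Sum>i<n. cnj (hinner (\<epsilon> i) x) * hinner (\<epsilon> i) y)"
proof -
  note E' = carrier_mat_adjoint[OF E_carrier]
  have coord: "vec_index (mat_adjoint E *\<^sub>v z) i = hinner (\<epsilon> i) z" if z: "z \<in> carrier_vec n" and i: "i < n" for z i
  proof -
    have "vec_index (mat_adjoint E *\<^sub>v z) i = hinner (unit_vec n i) (mat_adjoint E *\<^sub>v z)"
      using hinner_eq_sum[of "unit_vec n i" n "mat_adjoint E *\<^sub>v z"] mult_mat_vec_carrier[OF E' z] i
      by (simp add: if_distrib[of cnj] if_distrib[of "\<lambda>x. x * _"] cong: if_cong)
    also have "\<dots> = hinner (E *\<^sub>v unit_vec n i) z"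
      using hinner_mult_mat_vec[OF E' _ z, of "unit_vec n i"] by (simp add: mat_adjoint_adjoint[OF E_carrier])
    also have "E *\<^sub>v unit_vec n i = col E i"
      using i carrier_matD[OF E_carrier] by (intro eq_vecI) (simp_all add: scalar_prod_right_unit)
    finally show ?thesis by (simp add: col_E i)
  qed
  have "hinner x y = hinner (mat_adjoint E *\<^sub>v x) (mat_adjoint E *\<^sub>v y)"
    by (rule unitary_hinner[OF is_unitary_adjoint[OF unitary_E] x y, symmetric])
  also have "\<dots> = (\<Sum>i<n. cnj (hinner (\<epsilon> i) x) * hinner (\<epsilon> i) y)"
    unfolding hinner_eq_sum[OF mult_mat_vec_carrier[OF E' x] mult_mat_vec_carrier[OF E' y]]
    by (intro sum.cong refl) (simp add: coord x y del: index_mult_mat_vec)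
  finally show ?thesis .
qed

text \<open>\<open>V k\<close> is \<open>u\<close> stripped of its first \<open>k\<close> reflections.\<close>

primrec V :: "nat \<Rightarrow> complex mat" where
  "V 0 = u"
| "V (Suc k) = mat_adjoint (reflection_onto n (\<epsilon> k) (V k *\<^sub>v \<epsilon> k)) * V k"

definition r :: "nat \<Rightarrow> complex mat" where
  "r k = reflection_onto n (\<epsilon> k) (V k *\<^sub>v \<epsilon> k)"

lemma V_Suc: "V (Suc k) = mat_adjoint (r k) * V k"
  by (simp add: r_def)

declare V.simps(2) [simp del]

lemma r_carrier [simp]: "r k \<in> carrier_mat n n"
  by (simp add: r_def)

lemma V_carrier [simp]: "V k \<in> carrier_mat n n"
proof (induction k)
  case (Suc k)
  then show ?case unfolding V_Suc by (intro mult_carrier_mat[of _ n n] carrier_mat_adjoint r_carrier)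
qed (simp add: u_carrier)

lemma Veps_carrier [simp]: "j < n \<Longrightarrow> V k *\<^sub>v \<epsilon> j \<in> carrier_vec n"
  by (rule mult_mat_vec_carrier[OF V_carrier eps_carrier])

text \<open>Since \<open>V k\<close> preserves inner products in the frame and fixes
  \<open>\<epsilon> j\<close> for \<open>j < k\<close>, the vector
  \<open>V k *\<^sub>v \<epsilon> k - \<epsilon> k\<close> is orthogonal to each such
  \<open>\<epsilon> j\<close>. So \<open>r k\<close> fixes it as well, and stripping
  \<open>r k\<close> spoils nothing achieved before.\<close>

lemma V_properties:
  assumes "k \<le> n"
  shows "(\<forall>i<n. \<forall>j<n. hinner (V k *\<^sub>v \<epsilon> i) (V k *\<^sub>v \<epsilon> j) = (if i = j then 1 else 0)) \<and> (\<forall>j<k. V k *\<^sub>v \<epsilon> j = \<epsilon> j)"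
  using assms
proof (induction k)
  case 0
  then show ?case by (simp add: unitary_hinner[OF unitary] orthonormal)
next
  case (Suc k)
  then have kn: "k < n" by simp
  have iso: "hinner (V k *\<^sub>v \<epsilon> i) (V k *\<^sub>v \<epsilon> j) = (if i = j then 1 else 0)" if "i < n" "j < n" for i j
    using Suc that by simp
  have fix_eps: "V k *\<^sub>v \<epsilon> j = \<epsilon> j" if "j < k" for j
    using Suc that by simp
  let ?m = "V k *\<^sub>v \<epsilon> k"
  have mm: "hinner ?m ?m = 1" and ee: "hinner (\<epsilon> k) (\<epsilon> k) = 1" using iso[OF kn kn] orthonormal[OF kn kn] by auto
  note refl = unit_reflection[OF eps_carrier[OF kn] Veps_carrier[OF kn] ee mm, folded r_def]
  have step: "V (Suc k) *\<^sub>v \<epsilon> j = mat_adjoint (r k) *\<^sub>v (V k *\<^sub>v \<epsilon> j)" if "j < n" for j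
    unfolding V_Suc by (rule assoc_mult_mat_vec[OF carrier_mat_adjoint[OF r_carrier] V_carrier eps_carrier[OF that]])
  have inv_r: "mat_adjoint (r k) *\<^sub>v (r k *\<^sub>v x) = x" if "x \<in> carrier_vec n" for x
    using refl(2) that assoc_mult_mat_vec[OF carrier_mat_adjoint[OF r_carrier] r_carrier that, of k k]
    by (simp add: is_unitary_def)
  have "V (Suc k) *\<^sub>v \<epsilon> j = \<epsilon> j" if j: "j < Suc k" for j
  proof (cases "j = k")
    case True
    then show ?thesis using step[OF kn] inv_r[OF eps_carrier[OF kn]] refl(1) by simp
  next
    case False
    then have jk: "j < k" and jn: "j < n" using j kn by auto
    have "hinner (?m - \<epsilon> k) (\<epsilon> j) = hinner ?m (V k *\<^sub>v \<epsilon> j) - hinner (\<epsilon> k) (\<epsilon> j)"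
      using hinner_diff_left[OF eps_carrier[OF jn] Veps_carrier[OF kn] eps_carrier[OF kn]] fix_eps[OF jk] by simp
    also have "\<dots> = 0" using iso[OF kn jn] orthonormal[OF kn jn] jk by simp
    finally have "r k *\<^sub>v \<epsilon> j = \<epsilon> j"
      unfolding r_def reflection_onto_mult_vec[OF eps_carrier[OF kn] Veps_carrier[OF kn] eps_carrier[OF jn]]
      using eps_carrier[OF jn] eps_carrier[OF kn] by (intro eq_vecI) simp_all
    then show ?thesis using step[OF jn] fix_eps[OF jk] inv_r[OF eps_carrier[OF jn]] by simp
  qed
  moreover have "hinner (V (Suc k) *\<^sub>v \<epsilon> i) (V (Suc k) *\<^sub>v \<epsilon> j) = (if i = j then 1 else 0)" if "i < n" "j < n" for i j
    unfolding step[OF that(1)] step[OF that(2)]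
    using unitary_hinner[OF is_unitary_adjoint[OF refl(2)] Veps_carrier[OF that(1)] Veps_carrier[OF that(2)]] iso[OF that]
    by simp
  ultimately show ?case by blast
qed

lemma r_properties:
  assumes k: "k < n"
  shows "r k *\<^sub>v \<epsilon> k = V k *\<^sub>v \<epsilon> k" "is_unitary n (r k)" "is_reflection n (r k)"
proof -
  have "hinner (V k *\<^sub>v \<epsilon> k) (V k *\<^sub>v \<epsilon> k) = 1" using V_properties[of k] k by simp
  note unit_reflection[OF eps_carrier[OF k] Veps_carrier[OF k] _ this, folded r_def]
  then show "r k *\<^sub>v \<epsilon> k = V k *\<^sub>v \<epsilon> k" "is_unitary n (r k)" "is_reflection n (r k)"
    using orthonormal[OF k k] by auto
qed

text \<open>Reconciles the adjoints in the recursion for \<open>V\<close> with the descending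
  product of inverses by which the theorem describes the reflections.\<close>

lemma mprod_minv_r:
  assumes "k \<le> n" shows "mprod n (map (\<lambda>i. minv (r i)) (rev [0..<k])) * u = V k"
  using assms
proof (induction k)
  case (Suc k)
  let ?P = "mprod n (map (\<lambda>i. minv (r i)) (rev [0..<k]))"
  have minv: "minv (r i) = mat_adjoint (r i)" if "i < n" for i
    using minv_unitary r_properties(2)[OF that] by blast
  have P: "?P \<in> carrier_mat n n"
    using Suc.prems by (intro mprod_carrier) (auto simp: minv intro!: carrier_mat_adjoint)
  have "mprod n (map (\<lambda>i. minv (r i)) (rev [0..<Suc k])) * u = mat_adjoint (r k) * (?P * u)"
    using Suc.prems by (simp add: mprod_Cons minv assoc_mult_mat[OF carrier_mat_adjoint[OF r_carrier] P u_carrier])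
  also have "?P * u = V k" using Suc by simp
  finally show ?case by (simp only: V_Suc)
qed (use u_carrier in \<open>simp add: mprod_Nil\<close>)

lemma mprod_r_V:
  assumes "k \<le> n" shows "mprod n (map r [0..<k]) * V k = u"
  using assms
proof (induction k)
  case (Suc k)
  let ?P = "mprod n (map r [0..<k])"
  have P: "?P \<in> carrier_mat n n" by (intro mprod_carrier) auto
  have "mprod n (map r [0..<Suc k]) = ?P * r k"
    using mprod_snoc[of "map r [0..<k]" n "r k", OF _ r_carrier] by fastforce
  then have "mprod n (map r [0..<Suc k]) * V (Suc k) = ?P * (r k * (mat_adjoint (r k) * V k))"
    unfolding V_Suc by (simp add: assoc_mult_mat[OF P r_carrier mult_carrier_mat[OF carrier_mat_adjoint[OF r_carrier] V_carrier]])
  also have "r k * (mat_adjoint (r k) * V k) = V k"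
    using r_properties(2)[of k] Suc.prems
    by (simp add: assoc_mult_mat[OF r_carrier carrier_mat_adjoint[OF r_carrier] V_carrier, symmetric] is_unitary_def
        left_mult_one_mat[OF V_carrier])
  finally show ?case using Suc by simp
qed (use u_carrier in \<open>simp add: mprod_Nil\<close>)

lemma V_last: "V n = 1\<^sub>m n"
proof -
  have "V n * E = E"
  proof (rule mat_col_eqI)
    fix j assume "j < dim_col E"
    then have j: "j < n" using carrier_matD[OF E_carrier] by simp
    show "col (V n * E) j = col E j"
      using V_properties[of n] j by (simp add: col_mult2[OF V_carrier E_carrier j] col_E)
  qed (use carrier_matD[OF E_carrier] carrier_matD[OF V_carrier, of n] in simp_all)
  then have "V n * (E * mat_adjoint E) = E * mat_adjoint E"
    using assoc_mult_mat[OF V_carrier E_carrier carrier_mat_adjoint[OF E_carrier], of n] by simp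
  then show ?thesis using unitary_E right_mult_one_mat[OF V_carrier, of n] by (simp add: is_unitary_def)
qed

lemma product_of_reflections: "u = mprod n (map r [0..<n])"
proof -
  have "mprod n (map r [0..<n]) \<in> carrier_mat n n" by (intro mprod_carrier) auto
  then show ?thesis using mprod_r_V[of n] by (simp add: V_last)
qed

lemma conj_E_product: 
  "mat n n (\<lambda>(i, j). hinner (\<epsilon> i) (u *\<^sub>v \<epsilon> j)) = mprod n (map (\<lambda>k. mat n n (\<lambda>(i, j). hinner (\<epsilon> i) (r k *\<^sub>v \<epsilon> j))) [0..<n])"
proof -
  have conj: "mat n n (\<lambda>(i, j). hinner (\<epsilon> i) (A *\<^sub>v \<epsilon> j)) = mat_adjoint E * A * E" if A: "A \<in> carrier_mat n n" for A
    using carrier_matD[OF carrier_mat_adjoint[OF E_carrier]] carrier_matD[OF E_carrier]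
    by (intro eq_matI) (simp_all add: index_conj_E[OF A] del: index_mult_mat(1))
  have "mat_adjoint E * mprod n (map r [0..<n]) * E = mprod n (map (\<lambda>A. mat_adjoint E * A * E) (map r [0..<n]))"
    using unitary_E by (intro mprod_conj E_carrier carrier_mat_adjoint) (auto simp: is_unitary_def)
  then show ?thesis
    unfolding conj[OF u_carrier] product_of_reflections[symmetric] conj[OF r_carrier] by (simp add: comp_def)
qed

end

section \<open>Entries of the elementary factors\<close>

lemma Xi_block_carrier: "k < n \<Longrightarrow> Xi_block n k \<gamma> \<in> carrier_mat n n"
  by (auto simp: Xi_block_def Xi_def Let_def mat_of_rows_list_def four_block_mat_def)

lemma index_Xi_block:
  assumes "k < n" "i < n" "j < n"
  shows "index_mat (Xi_block n k \<gamma>) (i, j) =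
    (if Suc k < n then
       let \<rho> = of_real (sqrt (1 - (cmod \<gamma>)\<^sup>2)); ph = (1 - \<gamma>) / (1 - cnj \<gamma>) in
       if i = k \<and> j = k then \<gamma> else if i = k \<and> j = Suc k then \<rho> * ph
       else if i = Suc k \<and> j = k then \<rho> else if i = Suc k \<and> j = Suc k then - cnj \<gamma> * ph
       else if i = j then 1 else 0
     else if i = k \<and> j = k then \<gamma> else if i = j then 1 else 0)"
proof (cases "Suc k < n")
  case True
  obtain m where n: "n = k + 2 + m" using True le_Suc_ex[of "k + 2" n] by auto
  have Xi: "Xi \<gamma> \<in> carrier_mat 2 2" by (auto simp: Xi_def Let_def mat_of_rows_list_def)
  \<comment> \<open>The recursion of \<open>diag_block_mat\<close> ends with an empty matrix, the
    source of the blocks of dimension zero.\<close>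
  have block: "Xi_block n k \<gamma> = four_block_mat (1\<^sub>m k) (0\<^sub>m k (2 + m)) (0\<^sub>m (2 + m) k)
      (four_block_mat (Xi \<gamma>) (0\<^sub>m 2 m) (0\<^sub>m m 2) (four_block_mat (1\<^sub>m m) (0\<^sub>m m 0) (0\<^sub>m 0 m) (0\<^sub>m 0 0)))"
    using True carrier_matD[OF Xi] by (simp add: Xi_block_def n Let_def)
  have Xi_entries: "index_mat (Xi \<gamma>) (0, 0) = \<gamma>"
    "index_mat (Xi \<gamma>) (0, Suc 0) = of_real (sqrt (1 - (cmod \<gamma>)\<^sup>2)) * ((1 - \<gamma>) / (1 - cnj \<gamma>))"
    "index_mat (Xi \<gamma>) (Suc 0, 0) = of_real (sqrt (1 - (cmod \<gamma>)\<^sup>2))"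
    "index_mat (Xi \<gamma>) (Suc 0, Suc 0) = - cnj \<gamma> * ((1 - \<gamma>) / (1 - cnj \<gamma>))"
    by (simp_all add: Xi_def Let_def mat_of_rows_list_def)
  have pos: "x < k \<or> x = k \<or> x = Suc k \<or> (\<exists>y. x = k + 2 + y \<and> y < m)" if "x < n" for x
    using that le_Suc_ex[of "k + 2" x] unfolding n by (cases "k + 2 \<le> x") auto
  show ?thesis
    using pos[OF assms(2)] pos[OF assms(3)] True Xi_entries carrier_matD[OF Xi]
    unfolding block by (elim disjE exE conjE) (simp_all add: Let_def n)
next
  case False
  then have "k = n - 1" using assms by simp
  with False assms show ?thesis
    by (auto simp: Xi_block_def mat_of_rows_list_def)
qed

section \<open>Hessenberg unitaries and the parameters of their reflections\<close>

lemma sum_lessThan_two: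
  fixes f :: "nat \<Rightarrow> 'b::comm_monoid_add"
  assumes "Suc k < n" "\<And>i. i < n \<Longrightarrow> i \<noteq> k \<Longrightarrow> i \<noteq> Suc k \<Longrightarrow> f i = 0"
  shows "(\<Sum>i<n. f i) = f k + f (Suc k)"
proof -
  have "(\<Sum>i<n. f i) = (\<Sum>i\<in>{k, Suc k}. f i)"
    using assms by (intro sum.mono_neutral_right) auto
  then show ?thesis by simp
qed

text \<open>In the application \<open>p i\<close> is the value at \<open>1\<close> of the \<open>i\<close>-th orthonormal polynomial.\<close>

locale hessenberg_frame = orthonormal_frame +
  fixes b :: "nat \<Rightarrow> real" and p :: "nat \<Rightarrow> complex"
  assumes sub: "\<And>k. Suc k < n \<Longrightarrow> hinner (\<epsilon> (Suc k)) (u *\<^sub>v \<epsilon> k) = of_real (b k)"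
    and b_pos: "\<And>k. Suc k < n \<Longrightarrow> b k > 0"
    and below: "\<And>i k. Suc k < i \<Longrightarrow> i < n \<Longrightarrow> hinner (\<epsilon> i) (u *\<^sub>v \<epsilon> k) = 0"
    and fixed: "\<And>k. Suc k < n \<Longrightarrow> (\<Sum>i<n. p i * hinner (\<epsilon> i) (u *\<^sub>v \<epsilon> k)) = p k"
    and p_0: "p 0 \<noteq> 0"
begin

definition d :: "nat \<Rightarrow> complex vec" where "d k = V k *\<^sub>v \<epsilon> k - \<epsilon> k"

definition c :: "nat \<Rightarrow> complex" where "c k = refl_coeff (\<epsilon> k) (V k *\<^sub>v \<epsilon> k)"

definition a :: "nat \<Rightarrow> complex" where "a k = hinner (\<epsilon> k) (V k *\<^sub>v \<epsilon> k)"

lemma d_carrier [simp]: "k < n \<Longrightarrow> d k \<in> carrier_vec n"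
  by (simp add: d_def)

lemma hinner_r:
  assumes "k < n" "x \<in> carrier_vec n" "y \<in> carrier_vec n"
  shows "hinner x (r k *\<^sub>v y) = hinner x y - c k * hinner x (d k) * hinner (d k) y"
  unfolding r_def d_def c_def
  by (rule hinner_reflection_onto_right[OF eps_carrier[OF assms(1)] Veps_carrier[OF assms(1)] assms(3,2)])

lemma hinner_adjoint_r:
  assumes "k < n" "x \<in> carrier_vec n" "y \<in> carrier_vec n"
  shows "hinner x (mat_adjoint (r k) *\<^sub>v y) = hinner x y - cnj (c k) * hinner x (d k) * hinner (d k) y"
  unfolding hinner_mult_mat_vec[OF carrier_mat_adjoint[OF r_carrier] assms(2,3)] mat_adjoint_adjoint[OF r_carrier]
  unfolding r_def d_def c_def
  by (rule hinner_reflection_onto_left[OF eps_carrier[OF assms(1)] Veps_carrier[OF assms(1)] assms(3,2)])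

lemma V_Suc_eps:
  assumes "j < n" shows "V (Suc k) *\<^sub>v \<epsilon> j = mat_adjoint (r k) *\<^sub>v (V k *\<^sub>v \<epsilon> j)"
  unfolding V_Suc by (rule assoc_mult_mat_vec[OF carrier_mat_adjoint[OF r_carrier] V_carrier eps_carrier[OF assms]])

lemma hinner_eps_d:
  assumes "i < n" "k < n"
  shows "hinner (\<epsilon> i) (d k) = hinner (\<epsilon> i) (V k *\<^sub>v \<epsilon> k) - (if i = k then 1 else 0)"
  unfolding d_def using assms
  by (simp add: hinner_diff_right[OF eps_carrier Veps_carrier eps_carrier] orthonormal)

text \<open>The reflection \<open>r i\<close> only acts on the span of \<open>\<epsilon> i\<close> and \<open>\<epsilon> (Suc i)\<close>.\<close>

lemma V_below:
  assumes "k \<le> j" "j < i" "i < n"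
  shows "hinner (\<epsilon> i) (V k *\<^sub>v \<epsilon> j) = hinner (\<epsilon> i) (u *\<^sub>v \<epsilon> j)"
  using assms
proof (induction k arbitrary: i j)
  case (Suc k)
  then have kn: "k < n" and jn: "j < n" by auto
  \<comment> \<open>Here \<open>Suc k \<le> j < i\<close>, so \<open>i\<close> lies strictly beyond
    \<open>Suc k\<close>, where \<open>below\<close> makes the coordinates of \<open>d k\<close>
    vanish.\<close>
  have "hinner (\<epsilon> i) (d k) = 0"
    using Suc.IH[of k i] below[of k i] Suc.prems by (simp add: hinner_eps_d kn)
  then show ?case
    using hinner_adjoint_r[OF kn eps_carrier[OF Suc.prems(3)] Veps_carrier[OF jn]] Suc.IH[of j i] Suc.prems
    by (simp add: V_Suc_eps[OF jn])
qed simp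

text \<open>Above the diagonal the entries vanish because \<open>V k\<close> fixes the earlier basis
  vectors and preserves inner products; below it they are still those of \<open>u\<close>. Only the
  diagonal entry \<open>a k\<close> is new.\<close>

lemma hinner_eps_V:
  assumes "i < n" "k < n"
  shows "hinner (\<epsilon> i) (V k *\<^sub>v \<epsilon> k) = (if i = k then a k else if i = Suc k then of_real (b k) else 0)"
proof -
  consider "i < k" | "i = k" | "i = Suc k" | "Suc k < i" by linarith
  then show ?thesis
  proof cases
    case 1
    then have "V k *\<^sub>v \<epsilon> i = \<epsilon> i"
      using V_properties[of k] assms by simp
    moreover have "hinner (V k *\<^sub>v \<epsilon> i) (V k *\<^sub>v \<epsilon> k) = 0"
      using V_properties[THEN conjunct1, rule_format, of k i k] assms 1 by simp
    ultimately have "hinner (\<epsilon> i) (V k *\<^sub>v \<epsilon> k) = 0" by simp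
    then show ?thesis using 1 by simp
  qed (use V_below[of k k i] sub[of k] below[of k i] assms in \<open>auto simp: a_def\<close>)
qed

lemma a_b_norm:
  assumes k: "Suc k < n"
  shows "cnj (a k) * a k + of_real ((b k)\<^sup>2) = 1"
proof -
  have kn: "k < n" using k by simp
  have "hinner (V k *\<^sub>v \<epsilon> k) (V k *\<^sub>v \<epsilon> k) = 1" using V_properties[of k] kn by simp
  then have "(\<Sum>i<n. cnj (hinner (\<epsilon> i) (V k *\<^sub>v \<epsilon> k)) * hinner (\<epsilon> i) (V k *\<^sub>v \<epsilon> k)) = 1"
    using parseval[OF Veps_carrier[OF kn] Veps_carrier[OF kn], of k k] by simp
  then show ?thesis
    using sum_lessThan_two[OF k, of "\<lambda>i. cnj (hinner (\<epsilon> i) (V k *\<^sub>v \<epsilon> k)) * hinner (\<epsilon> i) (V k *\<^sub>v \<epsilon> k)"] k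
    by (simp add: hinner_eps_V power2_eq_square)
qed

text \<open>The functional \<open>x \<mapsto> (\<Sum>i<n. p i * \<langle>\<epsilon> i, x\<rangle>)\<close> vanishes on \<open>d k\<close>, so it is invariant under \<open>r k\<close>.\<close>

lemma functional_V:
  assumes "k < n" "j < n"
  shows "(\<Sum>i<n. p i * hinner (\<epsilon> i) (V k *\<^sub>v \<epsilon> j)) = (\<Sum>i<n. p i * hinner (\<epsilon> i) (u *\<^sub>v \<epsilon> j))"
  using assms
proof (induction k arbitrary: j)
  case (Suc k)
  then have kn: "k < n" by simp
  have "(\<Sum>i<n. p i * hinner (\<epsilon> i) (d k)) = (\<Sum>i<n. p i * hinner (\<epsilon> i) (V k *\<^sub>v \<epsilon> k)) - (\<Sum>i<n. if i = k then p i else 0)"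
    unfolding sum_subtractf[symmetric] by (intro sum.cong refl) (simp add: hinner_eps_d kn algebra_simps)
  \<comment> \<open>Since \<open>Suc k < n\<close>, the stripped column \<open>k\<close> is not the
    last one, which is exactly what \<open>fixed\<close> requires.\<close>
  also have "\<dots> = 0" using Suc.IH[OF kn kn] fixed[of k] Suc.prems kn by simp
  finally have zero: "(\<Sum>i<n. p i * hinner (\<epsilon> i) (d k)) = 0" .
  have "(\<Sum>i<n. p i * hinner (\<epsilon> i) (V (Suc k) *\<^sub>v \<epsilon> j)) = (\<Sum>i<n. p i * hinner (\<epsilon> i) (V k *\<^sub>v \<epsilon> j))
      - cnj (c k) * hinner (d k) (V k *\<^sub>v \<epsilon> j) * (\<Sum>i<n. p i * hinner (\<epsilon> i) (d k))"
    unfolding sum_distrib_left sum_subtractf[symmetric] V_Suc_eps[OF Suc.prems(2)]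
  proof (intro sum.cong refl)
    fix i assume "i \<in> {..<n}"
    then have i: "i < n" by simp
    show "p i * hinner (\<epsilon> i) (mat_adjoint (r k) *\<^sub>v (V k *\<^sub>v \<epsilon> j)) = p i * hinner (\<epsilon> i) (V k *\<^sub>v \<epsilon> j)
      - cnj (c k) * hinner (d k) (V k *\<^sub>v \<epsilon> j) * (p i * hinner (\<epsilon> i) (d k))"
      unfolding hinner_adjoint_r[OF kn eps_carrier[OF i] Veps_carrier[OF Suc.prems(2)]] by (simp add: algebra_simps)
  qed
  then show ?case using zero Suc.IH[OF kn Suc.prems(2)] by simp
qed simp

lemma a_p_relation:
  assumes k: "Suc k < n"
  shows "a k * p k + of_real (b k) * p (Suc k) = p k"
proof -
  have "(\<Sum>i<n. p i * hinner (\<epsilon> i) (V k *\<^sub>v \<epsilon> k)) = p k"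
    using functional_V[of k k] fixed[OF k] k by simp
  then show ?thesis
    using sum_lessThan_two[OF k, of "\<lambda>i. p i * hinner (\<epsilon> i) (V k *\<^sub>v \<epsilon> k)"] k
    by (simp add: hinner_eps_V mult.commute)
qed

text \<open>In the last column of \<open>V k\<close> only the diagonal entry survives. The
  functional is still the one of \<open>u\<close>, but \<open>fixed\<close> does not cover this
  column, so the right side is left to be evaluated by \<open>sum_mult_entry_last\<close>.\<close>

lemma a_p_last:
  assumes k: "Suc k = n"
  shows "a k * p k = (\<Sum>i<n. p i * hinner (\<epsilon> i) (u *\<^sub>v \<epsilon> k))"
proof -
  have kn: "k < n" using k by simp
  have "(\<Sum>i<n. p i * hinner (\<epsilon> i) (V k *\<^sub>v \<epsilon> k)) = (\<Sum>i<n. if i = k then a k * p k else 0)"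
    using k by (intro sum.cong refl) (auto simp: hinner_eps_V)
  then show ?thesis using functional_V[OF kn kn] kn by simp
qed

lemma a_neq_1:
  assumes k: "Suc k < n" shows "a k \<noteq> 1"
proof
  assume "a k = 1"
  then have "complex_of_real ((b k)\<^sup>2) = 0" using a_b_norm[OF k] by simp
  then show False using b_pos[OF k] by simp
qed

lemma p_nonzero: "k < n \<Longrightarrow> p k \<noteq> 0"
proof (induction k)
  case (Suc k)
  have "of_real (b k) * p (Suc k) = (1 - a k) * p k"
    using a_p_relation[OF Suc.prems] by (simp add: algebra_simps)
  then show ?case using a_neq_1[OF Suc.prems] Suc by auto
qed (rule p_0)

lemma b_eq:
  assumes k: "Suc k < n" shows "sqrt (1 - (cmod (a k))\<^sup>2) = b k"
proof -
  have "complex_of_real ((cmod (a k))\<^sup>2 + (b k)\<^sup>2) = 1"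
    using a_b_norm[OF k] complex_norm_square[of "a k"] by (simp add: mult.commute)
  then have "(cmod (a k))\<^sup>2 + (b k)\<^sup>2 = 1" using of_real_eq_1_iff by blast
  then have "1 - (cmod (a k))\<^sup>2 = (b k)\<^sup>2" by simp
  then show ?thesis using b_pos[OF k] by simp
qed

text \<open>In coordinates \<open>k\<close> and \<open>Suc k\<close> the vector \<open>d k\<close>
  is \<open>(a k - 1, b k)\<close>, and \<open>c k = 1 / (1 - cnj (a k))\<close>. The phase of
  \<open>Xi\<close> is thus \<open>- c k * (a k - 1)\<close>, and the relation
  \<open>(b k)\<^sup>2 = 1 - cnj (a k) * a k\<close> brings the lower right entry into its stated
  form.\<close>

lemma conj_r_eq_Xi_block:
  assumes k: "k < n"
  shows "mat n n (\<lambda>(i, j). hinner (\<epsilon> i) (r k *\<^sub>v \<epsilon> j)) = Xi_block n k (a k)"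
proof (rule eq_matI)
  fix i j assume "i < dim_row (Xi_block n k (a k))" "j < dim_col (Xi_block n k (a k))"
  then have i: "i < n" and j: "j < n" using carrier_matD[OF Xi_block_carrier[OF k, of "a k"]] by auto
  have "hinner (V k *\<^sub>v \<epsilon> k) (\<epsilon> k) = cnj (a k)"
    unfolding a_def by (rule cnj_hinner[OF eps_carrier[OF k] Veps_carrier[OF k], symmetric])
  then have c: "c k = 1 / (1 - cnj (a k))" by (simp add: c_def refl_coeff_def)
  have dj: "hinner (d k) (\<epsilon> j) = cnj (hinner (\<epsilon> j) (d k))"
    by (rule cnj_hinner[OF eps_carrier[OF j] d_carrier[OF k], symmetric])
  have dcoord: "hinner (\<epsilon> i) (d k) = (if i = k then a k - 1 else if i = Suc k then of_real (b k) else 0)" if "i < n" for i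
    using that k by (simp add: hinner_eps_d hinner_eps_V)
  have entry: "hinner (\<epsilon> i) (r k *\<^sub>v \<epsilon> j) = (if i = j then 1 else 0)
      - (1 / (1 - cnj (a k))) * hinner (\<epsilon> i) (d k) * cnj (hinner (\<epsilon> j) (d k))"
    using hinner_r[OF k eps_carrier[OF i] eps_carrier[OF j]] by (simp add: orthonormal i j c dj)
  show "index_mat (mat n n (\<lambda>(i, j). hinner (\<epsilon> i) (r k *\<^sub>v \<epsilon> j))) (i, j) = index_mat (Xi_block n k (a k)) (i, j)"
  proof (cases "Suc k < n")
    case True
    have ne: "1 - cnj (a k) \<noteq> 0" using a_neq_1[OF True] complex_cnj_cancel_iff[of "a k" 1] by auto
    have bb: "complex_of_real (b k) * of_real (b k) = 1 - cnj (a k) * a k"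
      using a_b_norm[OF True] by (simp add: power2_eq_square algebra_simps)
    have e1: "1 - 1 / (1 - cnj (a k)) * (a k - 1) * cnj (a k - 1) = a k"
      using ne by (simp add: field_simps)
    have e2: "0 - 1 / (1 - cnj (a k)) * (a k - 1) * cnj (of_real (b k)) = of_real (b k) * ((1 - a k) / (1 - cnj (a k)))"
      using ne by (simp add: field_simps)
    have e3: "0 - 1 / (1 - cnj (a k)) * of_real (b k) * cnj (a k - 1) = of_real (b k)"
      using ne by (simp add: field_simps)
    have e4: "1 - 1 / (1 - cnj (a k)) * of_real (b k) * cnj (of_real (b k)) = - cnj (a k) * ((1 - a k) / (1 - cnj (a k)))"
    proof -
      have "1 / (1 - cnj (a k)) * of_real (b k) * cnj (of_real (b k)) = (1 - cnj (a k) * a k) / (1 - cnj (a k))"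
        using bb by simp
      then show ?thesis using ne by (simp add: field_simps)
    qed
    show ?thesis
      unfolding index_Xi_block[OF k i j] Let_def b_eq[OF True] 
      using i j True e1 e2 e3 e4 by (auto simp only: index_mat(1) prod.case entry dcoord if_True if_False) auto
  next
    case False
    then have k': "Suc k = n" using k by simp
    \<comment> \<open>In the last column \<open>a k = 1\<close> is possible. Then the factor
      \<open>a k - 1\<close> vanishes, so the value of the division by zero does not matter, and the
      reflection is the identity.\<close>
    have "1 - 1 / (1 - cnj (a k)) * (a k - 1) * cnj (a k - 1) = a k"
    proof (cases "a k = 1")
      case False
      then have "1 - cnj (a k) \<noteq> 0" using complex_cnj_cancel_iff[of "a k" 1] by auto
      then show ?thesis by (simp add: field_simps)
    qed simp
    then show ?thesis
      unfolding index_Xi_block[OF k i j] using i j k' by (auto simp: entry dcoord)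
  qed
qed (use carrier_matD[OF Xi_block_carrier[OF k]] in auto)

lemma hessenberg_eq_Xi_product:
  "mat n n (\<lambda>(i, j). hinner (\<epsilon> i) (u *\<^sub>v \<epsilon> j)) = mprod n (map (\<lambda>k. Xi_block n k (a k)) [0..<n])"
  unfolding conj_E_product by (intro arg_cong[of _ _ "mprod n"] map_cong refl) (simp add: conj_r_eq_Xi_block)

end

section \<open>The frame of orthonormal polynomials and the deformed coefficients\<close>

context cyclic_unitary
begin

lemma hinner_ON_poly:
  "hinner (pv (sm.ON_poly i)) (pv (sm.ON_poly j)) = sm.ip (sm.ON_poly i) (sm.ON_poly j)"
  "hinner (pv (sm.ON_poly i)) (u *\<^sub>v pv (sm.ON_poly j)) = sm.mult_entry i j"
  by (simp_all only: sm.mult_entry_def ip_eq_h h_def pv_z)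

lemma hessenberg_frame_ON_poly:
  "hessenberg_frame n u (\<lambda>k. pv (sm.ON_poly k)) (\<lambda>k. sm.OP_norm (Suc k) / sm.OP_norm k) (\<lambda>k. poly (sm.ON_poly k) 1)"
proof
  note card = spectral_measure(2)
  show "is_unitary n u" by (rule unitary)
  show "pv (sm.ON_poly k) \<in> carrier_vec n" for k by simp
  show "hinner (pv (sm.ON_poly i)) (pv (sm.ON_poly j)) = (if i = j then 1 else 0)" if "i < n" "j < n" for i j
    using that sm.ip_ON_poly[of i j] unfolding hinner_ON_poly card by simp
  show "hinner (pv (sm.ON_poly (Suc k))) (u *\<^sub>v pv (sm.ON_poly k)) = of_real (sm.OP_norm (Suc k) / sm.OP_norm k)"
    if "Suc k < n" for k
    using that sm.mult_entry_Suc[of k] unfolding hinner_ON_poly card by simp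
  show "sm.OP_norm (Suc k) / sm.OP_norm k > 0" if "Suc k < n" for k
    using that sm.OP_norm_pos[of k] sm.OP_norm_pos[of "Suc k"] unfolding card by simp
  show "hinner (pv (sm.ON_poly i)) (u *\<^sub>v pv (sm.ON_poly k)) = 0" if "Suc k < i" "i < n" for i k
    using that sm.mult_entry_eq_0[of k i] unfolding hinner_ON_poly card by simp
  show "(\<Sum>i<n. poly (sm.ON_poly i) 1 * hinner (pv (sm.ON_poly i)) (u *\<^sub>v pv (sm.ON_poly k))) = poly (sm.ON_poly k) 1"
    if "Suc k < n" for k
    using that sm.sum_mult_entry[of k 1] unfolding hinner_ON_poly card by (simp add: mult.commute)
  show "poly (sm.ON_poly 0) 1 \<noteq> 0"
  proof -
    have "degree (OP 0) = 0" "OP 0 \<noteq> 0"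
      using sm.degree_monic_OP[of 0] sm.monic_OP_nonzero[of 0] by simp_all
    then have "poly (OP 0) 1 \<noteq> 0" by (auto elim!: degree_eq_zeroE)
    then show ?thesis using sm.OP_norm_pos[of 0] n_pos card by (simp add: sm.ON_poly_def)
  qed
qed

lemma deformed_verblunsky_eq:
  assumes k: "k < n"
  shows "deformed_verblunsky (spectral_measure n u e) k
    = hessenberg_frame.a n u (\<lambda>k. pv (sm.ON_poly k)) k"
proof -
  interpret hessenberg_frame n u "\<lambda>k. pv (sm.ON_poly k)" "\<lambda>k. sm.OP_norm (Suc k) / sm.OP_norm k"
    "\<lambda>k. poly (sm.ON_poly k) 1"
    by (rule hessenberg_frame_ON_poly)
  have N: "sm.OP_norm j > 0" if "j < n" for j
    using that sm.OP_norm_pos[of j] unfolding spectral_measure by simp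
  have ON: "poly (sm.ON_poly j) 1 = poly (OP j) 1 / of_real (sm.OP_norm j)" for j
    by (simp add: sm.ON_poly_def)
  have nz: "poly (OP k) 1 \<noteq> 0" using p_nonzero[OF k] by (auto simp: ON)
  \<comment> \<open>For the last index there is no next basis polynomial; the correction in
    \<open>sum_mult_entry_last\<close> takes the place of the subdiagonal term and yields the same
    equation.\<close>
  have "a k * poly (OP k) 1 = poly (OP k) 1 - poly (OP (Suc k)) 1"
  proof (cases "Suc k < n")
    case True
    have "a k * (poly (OP k) 1 / of_real (sm.OP_norm k)) + poly (OP (Suc k)) 1 / of_real (sm.OP_norm k)
        = poly (OP k) 1 / of_real (sm.OP_norm k)"
      using a_p_relation[OF True] N[OF True] by (simp add: ON)
    then show ?thesis using N[OF k] by (simp add: field_simps)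
  next
    case False
    then have k': "Suc k = n" using k by simp
    have "a k * poly (sm.ON_poly k) 1 = poly (sm.ON_poly k) 1 - poly (OP (Suc k)) 1 / of_real (sm.OP_norm k)"
      using a_p_last[OF k'] sm.sum_mult_entry_last[of k 1] k' unfolding hinner_ON_poly spectral_measure
      by (simp add: mult.commute)
    then show ?thesis using N[OF k] by (simp add: ON field_simps)
  qed
  then show ?thesis
    using nz by (simp add: deformed_verblunsky_def deformed_verblunsky_fun_def field_simps)
qed

lemma GGT_eq:
  "GGT n (verblunsky (spectral_measure n u e)) =
    mat n n (\<lambda>(i, j). hinner (pv (sm.ON_poly i)) (u *\<^sub>v pv (sm.ON_poly j)))"
  unfolding GGT_def hinner_ON_poly
  using sm.measure_of_verblunsky_eq[of n] sm.mult_matrix_eq[of n] by (simp add: spectral_measure)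

end

theorem theorem2p8:
  fixes n :: nat and u :: "complex mat" and e :: "complex vec"
    and \<mu> :: "complex measure" and \<alpha> \<gamma> :: "nat \<Rightarrow> complex" and \<epsilon> :: "nat \<Rightarrow> complex vec"
  assumes "is_unitary n u"
    and "e \<in> carrier_vec n" and "hnorm e = 1" and "cyclic_vector n u e"
    and "\<mu> = spectral_measure n u e"
    and "\<alpha> = verblunsky \<mu>"
    and "\<gamma> = deformed_verblunsky \<mu>"
    and "\<epsilon> = (\<lambda>k. gram_schmidt_onb n (krylov n u e) ! k)"
  shows "(\<exists>r :: nat \<Rightarrow> complex mat.
            (\<forall>k<n.
               let m = mprod n (map (\<lambda>i. minv (r i)) (rev [0..<k])) *\<^sub>v (u *\<^sub>v \<epsilon> k)
               in r k = reflection_onto n (\<epsilon> k) m \<and> is_reflection n (r k) \<and> r k *\<^sub>v \<epsilon> k = m) \<and>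
            u = mprod n (map r [0..<n]))
       \<and> GGT n \<alpha> = mprod n (map (\<lambda>k. Xi_block n k (\<gamma> k)) [0..<n])"
proof
  interpret cyclic_unitary n u e by (unfold_locales) (fact assms)+
  interpret hessenberg_frame n u "\<lambda>k. pv (sm.ON_poly k)" "\<lambda>k. sm.OP_norm (Suc k) / sm.OP_norm k"
    "\<lambda>k. poly (sm.ON_poly k) 1"
    by (rule hessenberg_frame_ON_poly)
  have eps: "\<epsilon> k = pv (sm.ON_poly k)" if "k < n" for k
    using gram_schmidt_onb_krylov[OF that] assms(8) by simp
  show "\<exists>r :: nat \<Rightarrow> complex mat.
            (\<forall>k<n.
               let m = mprod n (map (\<lambda>i. minv (r i)) (rev [0..<k])) *\<^sub>v (u *\<^sub>v \<epsilon> k)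
               in r k = reflection_onto n (\<epsilon> k) m \<and> is_reflection n (r k) \<and> r k *\<^sub>v \<epsilon> k = m) \<and>
            u = mprod n (map r [0..<n])"
  proof (intro exI[of _ r] conjI allI impI)
    fix k assume k: "k < n"
    have "mprod n (map (\<lambda>i. minv (r i)) (rev [0..<k])) \<in> carrier_mat n n"
    proof (rule mprod_carrier)
      fix A assume "A \<in> set (map (\<lambda>i. minv (r i)) (rev [0..<k]))"
      then obtain i where "i < k" and A: "A = minv (r i)" by auto
      then have "i < n" using k by simp
      with A show "A \<in> carrier_mat n n"
        using minv_unitary[OF r_properties(2)] by (simp add: carrier_mat_adjoint)
    qed
    \<comment> \<open>The witness \<open>r\<close> was built from \<open>V k\<close>; this
      identifies the target vector in the theorem with the one used there.\<close>
    from assoc_mult_mat_vec[OF this u_carrier eps_carrier[OF k]]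
    have "mprod n (map (\<lambda>i. minv (r i)) (rev [0..<k])) *\<^sub>v (u *\<^sub>v \<epsilon> k) = V k *\<^sub>v \<epsilon> k"
      using mprod_minv_r[of k] k by (simp add: eps[OF k])
    then show "let m = mprod n (map (\<lambda>i. minv (r i)) (rev [0..<k])) *\<^sub>v (u *\<^sub>v \<epsilon> k)
      in r k = reflection_onto n (\<epsilon> k) m \<and> is_reflection n (r k) \<and> r k *\<^sub>v \<epsilon> k = m"
      using r_properties[OF k] by (simp add: Let_def r_def eps[OF k])
  qed (rule product_of_reflections)
  have Xi: "map (\<lambda>k. Xi_block n k (\<gamma> k)) [0..<n] = map (\<lambda>k. Xi_block n k (a k)) [0..<n]"
    using deformed_verblunsky_eq assms by (intro map_cong) auto
  have "GGT n \<alpha> = mprod n (map (\<lambda>k. Xi_block n k (a k)) [0..<n])"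
    using GGT_eq hessenberg_eq_Xi_product assms(5,6) by simp
  then show "GGT n \<alpha> = mprod n (map (\<lambda>k. Xi_block n k (\<gamma> k)) [0..<n])"
    by (simp only: Xi)
qed

end
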